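(* Let $(M,J,g)$ be an almost Hermitian manifold and fix a local unitary $(1,0)$-frame. Then for all $i,j,k,l,m\in\{1,\dots,n\}$: (1) $\tau_{ik;l}^{\bar j}+\tau_{kl;i}^{\bar j}+\tau_{li;k}^{\bar j}=\tau_{i\lambda}^{\bar j}\tau_{kl}^\lambda+\tau_{k\lambda}^{\bar j}\tau_{li}^\lambda+\tau_{l\lambda}^{\bar j}\tau_{ik}^\lambda$; (2) $R_{i\bar j k\bar l}-R_{k\bar j i\bar l}=\tau^j_{ik;\bar l}-\tau^{\bar\lambda}_{ik}\tau^j_{\bar l\bar\lambda}$; (3) $R_{i\bar j k\bar l}-R_{i\bar l k\bar j}=\tau^{\bar i}_{\bar j\bar l;k}-\tau^{\bar i}_{k\lambda}\tau^{\lambda}_{\bar j\bar l}$; (4) $R_{i\bar j k\bar l}-R_{k\bar l i\bar j}=\tau_{ik;\bar j}^l+\tau_{\bar j\bar l;k}^{\bar i}-\tau_{k\lambda}^{\bar i}\tau_{\bar j\bar l}^\lambda-\tau_{\bar j\bar\lambda}^l\tau_{ik}^{\bar\lambda}$; (5) $R_{i\bar j kl}=-\tau_{kl;\bar j}^{\bar i}+\tau_{\bar j\bar\lambda}^{\bar i}\tau_{kl}^{\bar\lambda}$; (6) $R_{i\bar j kl}+R_{k\bar j li}+R_{l\bar j ik}=\tau^j_{ik;l}+\tau^j_{kl;i}+\tau^j_{li;k}-\tau^j_{i\lambda}\tau^\lambda_{kl}-\tau^j_{k\lambda}\tau^\lambda_{li}-\tau^j_{l\lambda}\tau^\lambda_{ik}$;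 (7) $R_{i\bar j kl;m}+R_{i\bar j lm;k}+R_{i\bar j mk;l}=\tau_{kl}^\lambda R_{i\bar j m\lambda}+\tau_{lm}^\lambda R_{i\bar j k\lambda}+\tau_{mk}^\lambda R_{i\bar j l\lambda}+\tau_{kl}^{\bar\lambda} R_{i\bar j m\bar\lambda}+\tau_{lm}^{\bar\lambda} R_{i\bar j k\bar\lambda}+\tau_{mk}^{\bar\lambda} R_{i\bar j l\bar\lambda}$; (8) $R_{i\bar j k\bar l;m}-R_{i\bar j m\bar l;k}=-R_{i\bar j mk;\bar l}-\tau_{mk}^\lambda R_{i\bar j\lambda\bar l}-\tau_{mk}^{\bar\lambda} R_{i\bar j\bar\lambda\bar l}$; (9) $R_{i\bar j k\bar l;\bar m}-R_{i\bar j k\bar m;\bar l}=-R_{i\bar j \bar l\bar m;k}-\tau_{\bar l\bar m}^\lambda R_{i\bar j\lambda k}+\tau_{\bar l\bar m}^{\bar\lambda} R_{i\bar j k\bar\lambda}$.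
   Context: An almost Hermitian manifold $(M,J,g)$ is a manifold $M$ of real dimension $2n$ with an almost complex structure $J$ and a Riemannian metric $g$ satisfying $g(JX,JY)=g(X,Y)$. Write $\langle\cdot,\cdot\rangle$ for the complex bilinear extension of $g$ to $TM\otimes\mathbb C$. The torsion of a connection $\nabla$ is $\tau(X,Y)=\nabla_XY-\nabla_YX-[X,Y]$. The canonical connection $\nabla$ is the unique connection with $\nabla g=0$, $\nabla J=0$ and $\tau(X,\overline Y)=0$ for all $(1,0)$-vectors $X,Y$ (tensors and connections are extended complex linearly); $\tau$ denotes its torsion and $R$ its curvature tensor, with $R(X,Y)Z=\nabla_X\nabla_YZ-\nabla_Y\nabla_XZ-\nabla_{[X,Y]}Z$ and $R(X,Y,Z,W)=\langle R(Z,W)X,Y\rangle$. A local unitary $(1,0)$-frame $(e_1,\dots,e_n)$ is a local frame of $T^{1,0}M$ with $\langle e_i,\overline{e_j}\rangle=\delta_{ij}$; $e_{\bar i}=\overline{e_i}$. For $A,B,C,D,E\in\{1,\bar1,\dots,n,\bar n\}$: $R_{ABCD}=R(e_A,e_B,e_C,e_D)$, $\tau(e_A,e_B)=\sum_C\tau_{AB}^Ce_C$, and ";" denotes components of covariant derivatives with respect to $\nabla$: $(\nabla_{e_C}\tau)(e_A,e_B)=\sum_D\tau_{AB;C}^De_D$, $R_{ABCD;E}=(\nabla_{e_E}R)(e_A,e_B,e_C,e_D)$. A repeated Greek index $\lambda$ is summed over $1,\dots,n$. *)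

theory Defs
  imports "HOL-Analysis.Analysis" "HOL-Library.Function_Algebras"
begin

section \<open>Smooth manifolds\<close>

text \<open>
  The library has no manifolds. The underlying space is a type of class t2_space and
  second_countable_topology, and the smooth structure is given by an atlas with values in a
  Euclidean space. Everything below is about open sets S, where the derivative is unambiguous.
\<close>

primrec Ck_on :: "nat \<Rightarrow> 'e::euclidean_space set \<Rightarrow> ('e \<Rightarrow> 'f::real_normed_vector) \<Rightarrow> bool" where
  "Ck_on 0 S f \<longleftrightarrow> continuous_on S f"
| "Ck_on (Suc k) S f \<longleftrightarrow> f differentiable_on S \<and>
     (\<forall>v. Ck_on k S (\<lambda>x. frechet_derivative f (at x) v))"

definition smooth_on :: "'e::euclidean_space set \<Rightarrow> ('e \<Rightarrow> 'f::real_normed_vector) \<Rightarrow> bool" where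
  "smooth_on S f \<longleftrightarrow> (\<forall>k. Ck_on k S f)"

type_synonym ('a, 'e) atlas = "('a set \<times> ('a \<Rightarrow> 'e)) set"

definition smooth_atlas ::
  "('a::{t2_space, second_countable_topology}, 'e::euclidean_space) atlas \<Rightarrow> bool" where
  "smooth_atlas \<A> \<longleftrightarrow>
     (\<Union>(D, \<phi>)\<in>\<A>. D) = UNIV \<and>
     (\<forall>(D, \<phi>)\<in>\<A>. open D \<and> open (\<phi> ` D) \<and> homeomorphism D (\<phi> ` D) \<phi> (inv_into D \<phi>)) \<and>
     (\<forall>(D, \<phi>)\<in>\<A>. \<forall>(D', \<phi>')\<in>\<A>. smooth_on (\<phi> ` (D \<inter> D')) (\<phi>' \<circ> inv_into D \<phi>))"

definition smooth_fun ::
  "('a::topological_space, 'e::euclidean_space) atlas \<Rightarrow> 'a set \<Rightarrow> ('a \<Rightarrow> real) \<Rightarrow> bool" where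
  "smooth_fun \<A> V f \<longleftrightarrow> (\<forall>(D, \<phi>)\<in>\<A>. smooth_on (\<phi> ` (D \<inter> V)) (f \<circ> inv_into D \<phi>))"

definition smooth_near ::
  "('a::topological_space, 'e::euclidean_space) atlas \<Rightarrow> 'a \<Rightarrow> ('a \<Rightarrow> real) \<Rightarrow> bool" where
  "smooth_near \<A> p f \<longleftrightarrow> (\<exists>V. open V \<and> p \<in> V \<and> smooth_fun \<A> V f)"

section \<open>Tangent vectors and vector fields\<close>

type_synonym 'a rvec = "('a \<Rightarrow> real) \<Rightarrow> real"
type_synonym 'a rfield = "'a \<Rightarrow> 'a rvec"

text \<open>
  A tangent vector at p is a derivation of the algebra of germs at p of smooth functions. It is
  represented as a function of all f, with value 0 where f is not smooth near p, so that equal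
  derivations are equal functions.
\<close>

definition tangent ::
  "('a::topological_space, 'e::euclidean_space) atlas \<Rightarrow> 'a \<Rightarrow> 'a rvec \<Rightarrow> bool" where
  "tangent \<A> p v \<longleftrightarrow>
     (\<forall>f. \<not> smooth_near \<A> p f \<longrightarrow> v f = 0) \<and>
     (\<forall>f h. smooth_near \<A> p f \<and> smooth_near \<A> p h \<and> (\<forall>\<^sub>F x in nhds p. f x = h x) \<longrightarrow> v f = v h) \<and>
     (\<forall>f h. smooth_near \<A> p f \<and> smooth_near \<A> p h \<longrightarrow> v (\<lambda>x. f x + h x) = v f + v h) \<and>
     (\<forall>c f. smooth_near \<A> p f \<longrightarrow> v (\<lambda>x. c * f x) = c * v f) \<and>
     (\<forall>f h. smooth_near \<A> p f \<and> smooth_near \<A> p h \<longrightarrow>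
        v (\<lambda>x. f x * h x) = v f * h p + f p * v h)"

text \<open>Smooth vector fields on an open set U; the values outside U are irrelevant.\<close>

definition vector_field ::
  "('a::topological_space, 'e::euclidean_space) atlas \<Rightarrow> 'a set \<Rightarrow> 'a rfield \<Rightarrow> bool" where
  "vector_field \<A> U X \<longleftrightarrow>
     (\<forall>p\<in>U. tangent \<A> p (X p)) \<and>
     (\<forall>V f. open V \<and> V \<subseteq> U \<and> smooth_fun \<A> V f \<longrightarrow> smooth_fun \<A> V (\<lambda>p. X p f))"

definition fmul :: "('a \<Rightarrow> real) \<Rightarrow> 'a rfield \<Rightarrow> 'a rfield" where
  "fmul f X = (\<lambda>p h. f p * X p h)"

text \<open>The case distinction keeps the value 0 on functions that are not smooth near the point.\<close>

definition lie_bracket ::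
  "('a::topological_space, 'e::euclidean_space) atlas \<Rightarrow> 'a rfield \<Rightarrow> 'a rfield \<Rightarrow> 'a rfield" where
  "lie_bracket \<A> X Y = (\<lambda>p f. if smooth_near \<A> p f
     then X p (\<lambda>q. Y q f) - Y p (\<lambda>q. X q f) else 0)"

section \<open>Complexification\<close>

text \<open>
  An element v + i w of the complexified tangent space at p is the complex valued derivation
  mapping f to v f + i (w f).
\<close>

type_synonym 'a cvec = "('a \<Rightarrow> real) \<Rightarrow> complex"
type_synonym 'a cfield = "'a \<Rightarrow> 'a cvec"

definition re_vec :: "'a cvec \<Rightarrow> 'a rvec" where "re_vec v = (\<lambda>f. Re (v f))"
definition im_vec :: "'a cvec \<Rightarrow> 'a rvec" where "im_vec v = (\<lambda>f. Im (v f))"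
definition cpx_vec :: "'a rvec \<Rightarrow> 'a rvec \<Rightarrow> 'a cvec" where
  "cpx_vec v w = (\<lambda>f. Complex (v f) (w f))"
definition cscale :: "complex \<Rightarrow> 'a cvec \<Rightarrow> 'a cvec" where "cscale c v = (\<lambda>f. c * v f)"

definition re_field :: "'a cfield \<Rightarrow> 'a rfield" where "re_field Z = (\<lambda>p. re_vec (Z p))"
definition im_field :: "'a cfield \<Rightarrow> 'a rfield" where "im_field Z = (\<lambda>p. im_vec (Z p))"
definition cnj_field :: "'a cfield \<Rightarrow> 'a cfield" where "cnj_field Z = (\<lambda>p f. cnj (Z p f))"

definition ctangent ::
  "('a::topological_space, 'e::euclidean_space) atlas \<Rightarrow> 'a \<Rightarrow> 'a cvec \<Rightarrow> bool" where
  "ctangent \<A> p v \<longleftrightarrow> tangent \<A> p (re_vec v) \<and> tangent \<A> p (im_vec v)"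

definition cvector_field ::
  "('a::topological_space, 'e::euclidean_space) atlas \<Rightarrow> 'a set \<Rightarrow> 'a cfield \<Rightarrow> bool" where
  "cvector_field \<A> U Z \<longleftrightarrow> vector_field \<A> U (re_field Z) \<and> vector_field \<A> U (im_field Z)"

text \<open>
  Complex linear extension of an endomorphism of the tangent spaces, complex bilinear extension
  of a bilinear form, and complex bilinear extension of a real bilinear operation on vector fields
  (used for connections and the Lie bracket).
\<close>

definition cext_endo :: "('a \<Rightarrow> 'a rvec \<Rightarrow> 'a rvec) \<Rightarrow> 'a \<Rightarrow> 'a cvec \<Rightarrow> 'a cvec" where
  "cext_endo J p v = cpx_vec (J p (re_vec v)) (J p (im_vec v))"

definition cext_form ::
  "('a \<Rightarrow> 'a rvec \<Rightarrow> 'a rvec \<Rightarrow> real) \<Rightarrow> 'a \<Rightarrow> 'a cvec \<Rightarrow> 'a cvec \<Rightarrow> complex" where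
  "cext_form g p v w = Complex
     (g p (re_vec v) (re_vec w) - g p (im_vec v) (im_vec w))
     (g p (re_vec v) (im_vec w) + g p (im_vec v) (re_vec w))"

definition cext_op :: "('a rfield \<Rightarrow> 'a rfield \<Rightarrow> 'a rfield) \<Rightarrow> 'a cfield \<Rightarrow> 'a cfield \<Rightarrow> 'a cfield" where
  "cext_op B Z W = (\<lambda>p. cpx_vec
     ((B (re_field Z) (re_field W) - B (im_field Z) (im_field W)) p)
     ((B (re_field Z) (im_field W) + B (im_field Z) (re_field W)) p))"

text \<open>The derivative of a complex valued function along a complex vector field.\<close>

definition cderiv :: "'a cfield \<Rightarrow> ('a \<Rightarrow> complex) \<Rightarrow> 'a \<Rightarrow> complex" where
  "cderiv Z h p = Z p (\<lambda>q. Re (h q)) + \<i> * Z p (\<lambda>q. Im (h q))"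

section \<open>Almost Hermitian manifolds\<close>

definition almost_complex_structure ::
  "('a::topological_space, 'e::euclidean_space) atlas \<Rightarrow> ('a \<Rightarrow> 'a rvec \<Rightarrow> 'a rvec) \<Rightarrow> bool" where
  "almost_complex_structure \<A> J \<longleftrightarrow>
     (\<forall>p v. tangent \<A> p v \<longrightarrow> tangent \<A> p (J p v) \<and> J p (J p v) = - v) \<and>
     (\<forall>p v w. tangent \<A> p v \<and> tangent \<A> p w \<longrightarrow> J p (v + w) = J p v + J p w) \<and>
     (\<forall>p v c. tangent \<A> p v \<longrightarrow> J p (\<lambda>f. c * v f) = (\<lambda>f. c * J p v f)) \<and>
     (\<forall>U X. open U \<and> vector_field \<A> U X \<longrightarrow> vector_field \<A> U (\<lambda>p. J p (X p)))"

definition riemannian_metric ::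
  "('a::topological_space, 'e::euclidean_space) atlas \<Rightarrow> ('a \<Rightarrow> 'a rvec \<Rightarrow> 'a rvec \<Rightarrow> real) \<Rightarrow> bool" where
  "riemannian_metric \<A> g \<longleftrightarrow>
     (\<forall>p v w. tangent \<A> p v \<and> tangent \<A> p w \<longrightarrow> g p v w = g p w v) \<and>
     (\<forall>p u v w. tangent \<A> p u \<and> tangent \<A> p v \<and> tangent \<A> p w \<longrightarrow>
        g p (u + v) w = g p u w + g p v w) \<and>
     (\<forall>p v w c. tangent \<A> p v \<and> tangent \<A> p w \<longrightarrow> g p (\<lambda>f. c * v f) w = c * g p v w) \<and>
     (\<forall>p v. tangent \<A> p v \<and> v \<noteq> 0 \<longrightarrow> g p v v > 0) \<and>
     (\<forall>U X Y. open U \<and> vector_field \<A> U X \<and> vector_field \<A> U Y \<longrightarrow>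
        smooth_fun \<A> U (\<lambda>p. g p (X p) (Y p)))"

definition almost_hermitian ::
  "('a::{t2_space, second_countable_topology}, 'e::euclidean_space) atlas \<Rightarrow>
   ('a \<Rightarrow> 'a rvec \<Rightarrow> 'a rvec) \<Rightarrow> ('a \<Rightarrow> 'a rvec \<Rightarrow> 'a rvec \<Rightarrow> real) \<Rightarrow> bool" where
  "almost_hermitian \<A> J g \<longleftrightarrow>
     smooth_atlas \<A> \<and> almost_complex_structure \<A> J \<and> riemannian_metric \<A> g \<and>
     (\<forall>p v w. tangent \<A> p v \<and> tangent \<A> p w \<longrightarrow> g p (J p v) (J p w) = g p v w)"

definition type10 ::
  "('a::topological_space, 'e::euclidean_space) atlas \<Rightarrow> ('a \<Rightarrow> 'a rvec \<Rightarrow> 'a rvec) \<Rightarrow>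
   'a \<Rightarrow> 'a cvec \<Rightarrow> bool" where
  "type10 \<A> J p v \<longleftrightarrow> ctangent \<A> p v \<and> cext_endo J p v = cscale \<i> v"

section \<open>Connections\<close>

text \<open>
  A connection acts on the vector fields of every open set U, compatibly with restriction: this is
  what the last clause says, since a field on U is also a field on each smaller open set. Only the
  values at points of U are constrained.
\<close>

definition connection ::
  "('a::topological_space, 'e::euclidean_space) atlas \<Rightarrow>
   ('a rfield \<Rightarrow> 'a rfield \<Rightarrow> 'a rfield) \<Rightarrow> bool" where
  "connection \<A> D \<longleftrightarrow> (\<forall>U. open U \<longrightarrow>
     (\<forall>X Y. vector_field \<A> U X \<and> vector_field \<A> U Y \<longrightarrow> vector_field \<A> U (D X Y)) \<and>
     (\<forall>X X' Y. vector_field \<A> U X \<and> vector_field \<A> U X' \<and> vector_field \<A> U Y \<longrightarrow>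
        (\<forall>p\<in>U. D (X + X') Y p = D X Y p + D X' Y p)) \<and>
     (\<forall>f X Y. smooth_fun \<A> U f \<and> vector_field \<A> U X \<and> vector_field \<A> U Y \<longrightarrow>
        (\<forall>p\<in>U. D (fmul f X) Y p = fmul f (D X Y) p)) \<and>
     (\<forall>X Y Y'. vector_field \<A> U X \<and> vector_field \<A> U Y \<and> vector_field \<A> U Y' \<longrightarrow>
        (\<forall>p\<in>U. D X (Y + Y') p = D X Y p + D X Y' p)) \<and>
     (\<forall>f X Y. smooth_fun \<A> U f \<and> vector_field \<A> U X \<and> vector_field \<A> U Y \<longrightarrow>
        (\<forall>p\<in>U. D X (fmul f Y) p = fmul (\<lambda>q. X q f) Y p + fmul f (D X Y) p)) \<and>
     (\<forall>X X' Y Y'. vector_field \<A> U X \<and> vector_field \<A> U Y \<and>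
        vector_field \<A> U X' \<and> vector_field \<A> U Y' \<and> (\<forall>p\<in>U. X p = X' p \<and> Y p = Y' p) \<longrightarrow>
        (\<forall>p\<in>U. D X Y p = D X' Y' p)))"

definition metric_connection ::
  "('a::topological_space, 'e::euclidean_space) atlas \<Rightarrow> ('a \<Rightarrow> 'a rvec \<Rightarrow> 'a rvec \<Rightarrow> real) \<Rightarrow>
   ('a rfield \<Rightarrow> 'a rfield \<Rightarrow> 'a rfield) \<Rightarrow> bool" where
  "metric_connection \<A> g D \<longleftrightarrow> (\<forall>U X Y Z. open U \<and>
     vector_field \<A> U X \<and> vector_field \<A> U Y \<and> vector_field \<A> U Z \<longrightarrow>
     (\<forall>p\<in>U. X p (\<lambda>q. g q (Y q) (Z q)) = g p (D X Y p) (Z p) + g p (Y p) (D X Z p)))"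

definition complex_connection ::
  "('a::topological_space, 'e::euclidean_space) atlas \<Rightarrow> ('a \<Rightarrow> 'a rvec \<Rightarrow> 'a rvec) \<Rightarrow>
   ('a rfield \<Rightarrow> 'a rfield \<Rightarrow> 'a rfield) \<Rightarrow> bool" where
  "complex_connection \<A> J D \<longleftrightarrow> (\<forall>U X Y. open U \<and> vector_field \<A> U X \<and> vector_field \<A> U Y \<longrightarrow>
     (\<forall>p\<in>U. D X (\<lambda>q. J q (Y q)) p = J p (D X Y p)))"

text \<open>
  Torsion, curvature and their covariant derivatives, all for the complex linear extensions of the
  connection D and of the Lie bracket.
\<close>

definition torsion ::
  "('a::topological_space, 'e::euclidean_space) atlas \<Rightarrow> ('a rfield \<Rightarrow> 'a rfield \<Rightarrow> 'a rfield) \<Rightarrow>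
   'a cfield \<Rightarrow> 'a cfield \<Rightarrow> 'a cfield" where
  "torsion \<A> D X Y = cext_op D X Y - cext_op D Y X - cext_op (lie_bracket \<A>) X Y"

definition curvature ::
  "('a::topological_space, 'e::euclidean_space) atlas \<Rightarrow> ('a rfield \<Rightarrow> 'a rfield \<Rightarrow> 'a rfield) \<Rightarrow>
   'a cfield \<Rightarrow> 'a cfield \<Rightarrow> 'a cfield \<Rightarrow> 'a cfield" where
  "curvature \<A> D X Y Z =
     cext_op D X (cext_op D Y Z) - cext_op D Y (cext_op D X Z)
     - cext_op D (cext_op (lie_bracket \<A>) X Y) Z"

definition curvature4 ::
  "('a::topological_space, 'e::euclidean_space) atlas \<Rightarrow> ('a \<Rightarrow> 'a rvec \<Rightarrow> 'a rvec \<Rightarrow> real) \<Rightarrow>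
   ('a rfield \<Rightarrow> 'a rfield \<Rightarrow> 'a rfield) \<Rightarrow>
   'a cfield \<Rightarrow> 'a cfield \<Rightarrow> 'a cfield \<Rightarrow> 'a cfield \<Rightarrow> 'a \<Rightarrow> complex" where
  "curvature4 \<A> g D X Y Z W p = cext_form g p (curvature \<A> D Z W X p) (Y p)"

text \<open>The first vector field argument V of the next two is the direction of differentiation.\<close>

definition nabla_torsion ::
  "('a::topological_space, 'e::euclidean_space) atlas \<Rightarrow> ('a rfield \<Rightarrow> 'a rfield \<Rightarrow> 'a rfield) \<Rightarrow>
   'a cfield \<Rightarrow> 'a cfield \<Rightarrow> 'a cfield \<Rightarrow> 'a cfield" where
  "nabla_torsion \<A> D V X Y =
     cext_op D V (torsion \<A> D X Y) - torsion \<A> D (cext_op D V X) Y - torsion \<A> D X (cext_op D V Y)"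

definition nabla_curvature4 ::
  "('a::topological_space, 'e::euclidean_space) atlas \<Rightarrow> ('a \<Rightarrow> 'a rvec \<Rightarrow> 'a rvec \<Rightarrow> real) \<Rightarrow>
   ('a rfield \<Rightarrow> 'a rfield \<Rightarrow> 'a rfield) \<Rightarrow>
   'a cfield \<Rightarrow> 'a cfield \<Rightarrow> 'a cfield \<Rightarrow> 'a cfield \<Rightarrow> 'a cfield \<Rightarrow> 'a \<Rightarrow> complex" where
  "nabla_curvature4 \<A> g D V X Y Z W p =
     cderiv V (curvature4 \<A> g D X Y Z W) p
     - curvature4 \<A> g D (cext_op D V X) Y Z W p
     - curvature4 \<A> g D X (cext_op D V Y) Z W p
     - curvature4 \<A> g D X Y (cext_op D V Z) W p
     - curvature4 \<A> g D X Y Z (cext_op D V W) p"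

definition canonical_connection ::
  "('a::topological_space, 'e::euclidean_space) atlas \<Rightarrow> ('a \<Rightarrow> 'a rvec \<Rightarrow> 'a rvec) \<Rightarrow>
   ('a \<Rightarrow> 'a rvec \<Rightarrow> 'a rvec \<Rightarrow> real) \<Rightarrow> ('a rfield \<Rightarrow> 'a rfield \<Rightarrow> 'a rfield) \<Rightarrow> bool" where
  "canonical_connection \<A> J g D \<longleftrightarrow>
     connection \<A> D \<and> metric_connection \<A> g D \<and> complex_connection \<A> J D \<and>
     (\<forall>U X Y. open U \<and> cvector_field \<A> U X \<and> cvector_field \<A> U Y \<and>
        (\<forall>p\<in>U. type10 \<A> J p (X p) \<and> type10 \<A> J p (Y p)) \<longrightarrow>
        (\<forall>p\<in>U. torsion \<A> D X (cnj_field Y) p = 0))"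

section \<open>Unitary frames and components\<close>

definition unitary_frame ::
  "('a::topological_space, 'e::euclidean_space) atlas \<Rightarrow> ('a \<Rightarrow> 'a rvec \<Rightarrow> 'a rvec) \<Rightarrow>
   ('a \<Rightarrow> 'a rvec \<Rightarrow> 'a rvec \<Rightarrow> real) \<Rightarrow> 'a set \<Rightarrow> ('n::finite \<Rightarrow> 'a cfield) \<Rightarrow> bool" where
  "unitary_frame \<A> J g U e \<longleftrightarrow>
     open U \<and> (\<forall>i. cvector_field \<A> U (e i)) \<and>
     (\<forall>p\<in>U. (\<forall>i. type10 \<A> J p (e i p)) \<and>
       (\<forall>v. type10 \<A> J p v \<longrightarrow> (\<exists>!c. v = (\<Sum>i\<in>UNIV. cscale (c i) (e i p)))) \<and>
       (\<forall>i j. cext_form g p (e i p) (cnj_field (e j) p) = (if i = j then 1 else 0)))"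

text \<open>The indices 1, ..., n are the elements of 'n; barred and unbarred indices form the type 'n + 'n.\<close>

abbreviation hol :: "'n \<Rightarrow> 'n + 'n" where "hol \<equiv> Inl"
abbreviation bar :: "'n \<Rightarrow> 'n + 'n" where "bar \<equiv> Inr"

definition full_frame :: "('n \<Rightarrow> 'a cfield) \<Rightarrow> 'n + 'n \<Rightarrow> 'a cfield" where
  "full_frame e a = (case a of Inl i \<Rightarrow> e i | Inr i \<Rightarrow> cnj_field (e i))"

definition frame_coeff :: "('n::finite \<Rightarrow> 'a cfield) \<Rightarrow> 'a \<Rightarrow> 'a cvec \<Rightarrow> 'n + 'n \<Rightarrow> complex" where
  "frame_coeff e p v = (THE c. v = (\<Sum>a\<in>UNIV. cscale (c a) (full_frame e a p)))"

text \<open>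
  Index order: torsion_comp a b c is the component with lower indices a b and upper index c;
  nabla_torsion_comp a b c d has lower indices a b ; c and upper index d;
  nabla_curvature_comp a b c d m has indices a b c d ; m.
\<close>

definition torsion_comp ::
  "('a::topological_space, 'e::euclidean_space) atlas \<Rightarrow> ('a rfield \<Rightarrow> 'a rfield \<Rightarrow> 'a rfield) \<Rightarrow>
   ('n::finite \<Rightarrow> 'a cfield) \<Rightarrow> 'a \<Rightarrow> 'n + 'n \<Rightarrow> 'n + 'n \<Rightarrow> 'n + 'n \<Rightarrow> complex" where
  "torsion_comp \<A> D e p a b c =
     frame_coeff e p (torsion \<A> D (full_frame e a) (full_frame e b) p) c"

definition nabla_torsion_comp ::
  "('a::topological_space, 'e::euclidean_space) atlas \<Rightarrow> ('a rfield \<Rightarrow> 'a rfield \<Rightarrow> 'a rfield) \<Rightarrow>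
   ('n::finite \<Rightarrow> 'a cfield) \<Rightarrow> 'a \<Rightarrow> 'n + 'n \<Rightarrow> 'n + 'n \<Rightarrow> 'n + 'n \<Rightarrow> 'n + 'n \<Rightarrow> complex" where
  "nabla_torsion_comp \<A> D e p a b c d =
     frame_coeff e p
       (nabla_torsion \<A> D (full_frame e c) (full_frame e a) (full_frame e b) p) d"

definition curvature_comp ::
  "('a::topological_space, 'e::euclidean_space) atlas \<Rightarrow> ('a \<Rightarrow> 'a rvec \<Rightarrow> 'a rvec \<Rightarrow> real) \<Rightarrow>
   ('a rfield \<Rightarrow> 'a rfield \<Rightarrow> 'a rfield) \<Rightarrow> ('n::finite \<Rightarrow> 'a cfield) \<Rightarrow> 'a \<Rightarrow>
   'n + 'n \<Rightarrow> 'n + 'n \<Rightarrow> 'n + 'n \<Rightarrow> 'n + 'n \<Rightarrow> complex" where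
  "curvature_comp \<A> g D e p a b c d =
     curvature4 \<A> g D (full_frame e a) (full_frame e b) (full_frame e c) (full_frame e d) p"

definition nabla_curvature_comp ::
  "('a::topological_space, 'e::euclidean_space) atlas \<Rightarrow> ('a \<Rightarrow> 'a rvec \<Rightarrow> 'a rvec \<Rightarrow> real) \<Rightarrow>
   ('a rfield \<Rightarrow> 'a rfield \<Rightarrow> 'a rfield) \<Rightarrow> ('n::finite \<Rightarrow> 'a cfield) \<Rightarrow> 'a \<Rightarrow>
   'n + 'n \<Rightarrow> 'n + 'n \<Rightarrow> 'n + 'n \<Rightarrow> 'n + 'n \<Rightarrow> 'n + 'n \<Rightarrow> complex" where
  "nabla_curvature_comp \<A> g D e p a b c d m =
     nabla_curvature4 \<A> g D (full_frame e m)
       (full_frame e a) (full_frame e b) (full_frame e c) (full_frame e d) p"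

end

theory Submission
  imports Defs
begin

text \<open>
  Expanding the definitions, Jacobi's identity for the Lie bracket gives both Bianchi identities of a
  connection with torsion, as identities of complex vector fields. Torsion and curvature are
  linear over the smooth functions, so the terms \<open>\<tau>(\<tau>(X, Y), Z)\<close> and \<open>R(\<tau>(X, Y), Z)\<close> can be
  expanded in the frame without localising. As \<open>\<nabla>\<close> preserves the types, most components then vanish:
  \<open>R(X, Y)\<close> maps (1,0)-vectors to (1,0)-vectors, two vectors of the same type are orthogonal, and
  \<open>\<tau>\<close> and \<open>\<nabla>\<tau>\<close> vanish on arguments of mixed type.
\<close>

section \<open>Smooth functions\<close>

text \<open>Fields and operators are total functions, but their values outside U, and the values of
  vectors on functions that are not smooth, are mere defaults. So most equations between fields hold
  only at points of U, and they can be inserted under \<open>nab\<close>, \<open>tor\<close> or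
  \<open>curv\<close> only through congruence rules; these hold because U is open and the operators
  are local. A second obstacle is that \<open>D\<close> acts on real fields. Linearity over complex
  functions, the Leibniz rule, the metric property and the preservation of types are recovered from
  real and imaginary parts, after which the computations stay complex. Expansion without localising
  works because the frame is given on all of U and the coefficients, pairings with conjugate frame
  vectors, are smooth there. The identities then differ in the types of the indices put into the two
  Bianchi identities. The metric also makes R skew in its first two indices, which brings a barred
  index back to the second place.\<close>

lemma Ck_on_subset: "Ck_on k S f \<Longrightarrow> T \<subseteq> S \<Longrightarrow> Ck_on k T f"
  by (induction k arbitrary: f) (auto intro: continuous_on_subset differentiable_on_subset)

lemma Ck_on_Suc_imp: "Ck_on (Suc k) S f \<Longrightarrow> Ck_on k S f"
  by (induction k arbitrary: f) (auto intro: differentiable_imp_continuous_on)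

text \<open>\<open>frechet_derivative\<close> is a choice among the derivatives in the sense of
  \<open>has_derivative\<close>, so it is enough that f and h have the same ones. This covers points
  where neither is differentiable.\<close>

lemma frechet_derivative_cong_open:
  assumes "open S" "x \<in> S" "\<And>y. y \<in> S \<Longrightarrow> f y = h y"
  shows "frechet_derivative f (at x) = frechet_derivative h (at x)"
proof -
  have "(f has_derivative f') (at x) \<longleftrightarrow> (h has_derivative f') (at x)" for f'
    using assms by (metis has_derivative_transform_within_open)
  then show ?thesis by (simp add: frechet_derivative_def)
qed

text \<open>Openness of S makes the derivatives depend only on values in S. The rule is needed
  because the sum and product rules identify a derivative only at points of S.\<close>

lemma Ck_on_cong:
  assumes "open S" "\<And>x. x \<in> S \<Longrightarrow> f x = h x" "Ck_on k S f"
  shows "Ck_on k S h"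
  using assms(2,3)
proof (induction k arbitrary: f h)
  case 0
  then show ?case by (simp cong: continuous_on_cong)
next
  case (Suc k)
  have "h differentiable_on S"
    using Suc.prems by (auto simp: differentiable_on_def intro: differentiable_transform_within[where d = 1])
  moreover have "Ck_on k S (\<lambda>x. frechet_derivative h (at x) v)" for v
  proof (rule Suc.IH)
    show "Ck_on k S (\<lambda>x. frechet_derivative f (at x) v)" using Suc.prems(2) by simp
    fix x assume "x \<in> S"
    then show "frechet_derivative f (at x) v = frechet_derivative h (at x) v"
      using frechet_derivative_cong_open[OF assms(1) _ Suc.prems(1), of x] by simp
  qed
  ultimately show ?case by simp
qed

lemma Ck_on_const: "Ck_on k S (\<lambda>x. c)"
  by (induction k arbitrary: c) (auto simp: frechet_derivative_const)

lemma Ck_on_add: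
  fixes f h :: "'e::euclidean_space \<Rightarrow> real"
  assumes "open S" "Ck_on k S f" "Ck_on k S h"
  shows "Ck_on k S (\<lambda>x. f x + h x)"
  using assms(2,3)
proof (induction k arbitrary: f h)
  case 0
  then show ?case by (auto intro: continuous_on_add)
next
  case (Suc k)
  have at: "f differentiable at x" "h differentiable at x" if "x \<in> S" for x
    using that Suc.prems assms(1) by (auto simp: differentiable_on_eq_differentiable_at)
  have "Ck_on k S (\<lambda>x. frechet_derivative (\<lambda>x. f x + h x) (at x) v)" for v
  proof (rule Ck_on_cong[OF assms(1)])
    show "Ck_on k S (\<lambda>x. frechet_derivative f (at x) v + frechet_derivative h (at x) v)"
      using Suc by simp
  next
    fix x assume "x \<in> S"
    show "frechet_derivative f (at x) v + frechet_derivative h (at x) v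
      = frechet_derivative (\<lambda>x. f x + h x) (at x) v"
      using frechet_derivative_at[OF has_derivative_add[OF
        at(1)[OF \<open>x \<in> S\<close>, unfolded frechet_derivative_works] at(2)[OF \<open>x \<in> S\<close>, unfolded frechet_derivative_works]]]
      by metis
  qed
  then show ?case using Suc.prems by (auto intro: differentiable_on_add)
qed

lemma Ck_on_mult:
  fixes f h :: "'e::euclidean_space \<Rightarrow> real"
  assumes "open S" "Ck_on k S f" "Ck_on k S h"
  shows "Ck_on k S (\<lambda>x. f x * h x)"
  using assms(2,3)
proof (induction k arbitrary: f h)
  case 0
  then show ?case by (auto intro: continuous_on_mult)
next
  case (Suc k)
  have at: "f differentiable at x" "h differentiable at x" if "x \<in> S" for x
    using that Suc.prems assms(1) by (auto simp: differentiable_on_eq_differentiable_at)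
  have "Ck_on k S (\<lambda>x. frechet_derivative (\<lambda>x. f x * h x) (at x) v)" for v
  proof (rule Ck_on_cong[OF assms(1)])
    show "Ck_on k S (\<lambda>x. f x * frechet_derivative h (at x) v + frechet_derivative f (at x) v * h x)"
      \<comment> \<open>The product rule keeps one factor undifferentiated; that factor is lowered
        from order k + 1 to order k by \<open>Ck_on_Suc_imp\<close>.\<close>
      using Suc.prems by (intro Ck_on_add[OF assms(1)] Suc.IH) (auto intro: Ck_on_Suc_imp simp del: Ck_on.simps simp: Ck_on.simps(2)[of k])
  next
    fix x assume "x \<in> S"
    show "f x * frechet_derivative h (at x) v + frechet_derivative f (at x) v * h x
      = frechet_derivative (\<lambda>x. f x * h x) (at x) v"
      using frechet_derivative_at[OF has_derivative_mult[OF
        at(1)[OF \<open>x \<in> S\<close>, unfolded frechet_derivative_works] at(2)[OF \<open>x \<in> S\<close>, unfolded frechet_derivative_works]]]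
      by metis
  qed
  then show ?case using Suc.prems by (auto intro: differentiable_on_mult)
qed

section \<open>Smooth functions on a manifold\<close>

locale smooth_manifold =
  fixes \<A> :: "('a::{t2_space, second_countable_topology}, 'e::euclidean_space) atlas"
  assumes atlas: "smooth_atlas \<A>"
begin

text \<open>A chart is a homeomorphism onto an open set, so it maps relatively open sets to open
  ones. This makes the rules for \<open>Ck_on\<close> on open sets available in every chart.\<close>

lemma open_chart_image:
  assumes "(D, \<phi>) \<in> \<A>" "open V"
  shows "open (\<phi> ` (D \<inter> V))"
proof -
  have h: "homeomorphism D (\<phi> ` D) \<phi> (inv_into D \<phi>)" and o: "open (\<phi> ` D)"
    using atlas assms(1) unfolding smooth_atlas_def by auto
  have "openin (top_of_set (\<phi> ` D)) (\<phi> ` (D \<inter> V))"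
    using homeomorphism_imp_open_map[OF h] assms(2) by (simp add: openin_open_Int)
  then show ?thesis using o by (simp add: openin_open_eq)
qed

lemma smooth_fun_subset: "smooth_fun \<A> V f \<Longrightarrow> W \<subseteq> V \<Longrightarrow> smooth_fun \<A> W f"
  unfolding smooth_fun_def smooth_on_def
  by (fastforce elim: Ck_on_subset)

lemma smooth_fun_cong:
  assumes "open V" "\<And>x. x \<in> V \<Longrightarrow> f x = h x" "smooth_fun \<A> V f"
  shows "smooth_fun \<A> V h"
  unfolding smooth_fun_def smooth_on_def
proof (clarify)
  fix D \<phi> k assume D: "(D, \<phi>) \<in> \<A>"
  have "homeomorphism D (\<phi> ` D) \<phi> (inv_into D \<phi>)"
    using D atlas unfolding smooth_atlas_def by auto
  then have "inj_on \<phi> D"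
    by (rule inj_on_inverseI[OF homeomorphism_apply1])
  \<comment> \<open>Injectivity is what sends a point of the image of D \<inter> V back into V,
    where f and h agree.\<close>
  then have "(f \<circ> inv_into D \<phi>) y = (h \<circ> inv_into D \<phi>) y" if "y \<in> \<phi> ` (D \<inter> V)" for y
    using that assms(2) by auto
  moreover have "Ck_on k (\<phi> ` (D \<inter> V)) (f \<circ> inv_into D \<phi>)"
    using assms(3) D unfolding smooth_fun_def smooth_on_def by auto
  ultimately show "Ck_on k (\<phi> ` (D \<inter> V)) (h \<circ> inv_into D \<phi>)"
    by (rule Ck_on_cong[OF open_chart_image[OF D assms(1)]])
qed

lemma smooth_fun_const: "smooth_fun \<A> V (\<lambda>x. c)"
  by (auto simp: smooth_fun_def smooth_on_def o_def Ck_on_const)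

lemma smooth_fun_add:
  "open V \<Longrightarrow> smooth_fun \<A> V f \<Longrightarrow> smooth_fun \<A> V h \<Longrightarrow> smooth_fun \<A> V (\<lambda>x. f x + h x)"
  by (auto simp: smooth_fun_def smooth_on_def o_def dest!: bspec intro!: Ck_on_add open_chart_image)

lemma smooth_fun_mult:
  "open V \<Longrightarrow> smooth_fun \<A> V f \<Longrightarrow> smooth_fun \<A> V h \<Longrightarrow> smooth_fun \<A> V (\<lambda>x. f x * h x)"
  by (auto simp: smooth_fun_def smooth_on_def o_def dest!: bspec intro!: Ck_on_mult open_chart_image)

lemma smooth_fun_uminus:
  "open V \<Longrightarrow> smooth_fun \<A> V f \<Longrightarrow> smooth_fun \<A> V (\<lambda>x. - f x)"
  using smooth_fun_mult[OF _ smooth_fun_const[of V "-1"]] by simp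

lemma smooth_fun_diff:
  "open V \<Longrightarrow> smooth_fun \<A> V f \<Longrightarrow> smooth_fun \<A> V h \<Longrightarrow> smooth_fun \<A> V (\<lambda>x. f x - h x)"
  using smooth_fun_add[OF _ _ smooth_fun_uminus, of V f h] by simp

lemma smooth_near2:
  assumes "smooth_near \<A> p f" "smooth_near \<A> p h"
  obtains V where "open V" "p \<in> V" "smooth_fun \<A> V f" "smooth_fun \<A> V h"
proof -
  obtain V W where "open V" "p \<in> V" "smooth_fun \<A> V f" "open W" "p \<in> W" "smooth_fun \<A> W h"
    using assms unfolding smooth_near_def by auto
  then show ?thesis
    using that[of "V \<inter> W"] smooth_fun_subset[of V f "V \<inter> W"] smooth_fun_subset[of W h "V \<inter> W"] by auto
qed

lemma smooth_near_const: "smooth_near \<A> p (\<lambda>x. c)"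
  unfolding smooth_near_def by (rule exI[of _ UNIV]) (simp add: smooth_fun_const)

lemma smooth_near_add:
  "smooth_near \<A> p f \<Longrightarrow> smooth_near \<A> p h \<Longrightarrow> smooth_near \<A> p (\<lambda>x. f x + h x)"
  by (erule (1) smooth_near2) (auto simp: smooth_near_def intro: smooth_fun_add)

lemma smooth_near_mult:
  "smooth_near \<A> p f \<Longrightarrow> smooth_near \<A> p h \<Longrightarrow> smooth_near \<A> p (\<lambda>x. f x * h x)"
  by (erule (1) smooth_near2) (auto simp: smooth_near_def intro: smooth_fun_mult)

lemma smooth_near_uminus: "smooth_near \<A> p f \<Longrightarrow> smooth_near \<A> p (\<lambda>x. - f x)"
  using smooth_near_mult[OF smooth_near_const[of p "-1"]] by simp

lemma smooth_near_diff:
  "smooth_near \<A> p f \<Longrightarrow> smooth_near \<A> p h \<Longrightarrow> smooth_near \<A> p (\<lambda>x. f x - h x)"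
  using smooth_near_add[OF _ smooth_near_uminus, of p f h] by simp

lemma smooth_near_cong:
  assumes "\<forall>\<^sub>F x in nhds p. f x = h x" "smooth_near \<A> p f"
  shows "smooth_near \<A> p h"
proof -
  obtain W where W: "open W" "p \<in> W" "\<And>x. x \<in> W \<Longrightarrow> f x = h x"
    using assms(1) unfolding eventually_nhds by auto
  obtain V where V: "open V" "p \<in> V" "smooth_fun \<A> V f"
    using assms(2) unfolding smooth_near_def by auto
  have "smooth_fun \<A> (V \<inter> W) h"
    using W V smooth_fun_subset[OF V(3), of "V \<inter> W"] smooth_fun_cong[of "V \<inter> W" f h] by auto
  then show ?thesis using W V unfolding smooth_near_def by (metis IntI open_Int)
qed

lemma eventually_smooth_near:
  assumes "smooth_near \<A> p f"
  shows "\<forall>\<^sub>F x in nhds p. smooth_near \<A> x f"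
  using assms unfolding smooth_near_def eventually_nhds by metis

end

section \<open>Complex tangent vectors and fields\<close>

definition cmul :: "('a \<Rightarrow> complex) \<Rightarrow> 'a cfield \<Rightarrow> 'a cfield" where
  "cmul h Z = (\<lambda>p. cscale (h p) (Z p))"

lemma cscale_simps [simp]: "cscale 0 v = 0" "cscale (- 1) v = - v" "cscale 1 v = v" "cscale c 0 = 0"
  by (simp_all add: fun_eq_iff cscale_def)

text \<open>With differences, negatives and zero written through \<open>cmul\<close>, their rules
  follow from additivity and linearity over functions.\<close>

lemma cdiff_eq_cmul: "X - Y = X + cmul (\<lambda>_. - 1) (Y :: 'a cfield)"
  by (simp add: fun_eq_iff cmul_def cscale_def)

lemma cuminus_eq_cmul: "- Y = cmul (\<lambda>_. - 1) (Y :: 'a cfield)"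
  by (simp add: fun_eq_iff cmul_def cscale_def)

lemma czero_eq_cmul: "0 = cmul (\<lambda>_. 0) (0 :: 'a cfield)"
  by (simp add: fun_eq_iff cmul_def cscale_def)

text \<open>Taking real and imaginary parts of each equation gives the tangency of the two parts.
  Complex vectors can thus be handled as complex valued derivations of real functions.\<close>

lemma ctangent_iff:
  "ctangent \<A> p v \<longleftrightarrow>
     (\<forall>f. \<not> smooth_near \<A> p f \<longrightarrow> v f = 0) \<and>
     (\<forall>f h. smooth_near \<A> p f \<and> smooth_near \<A> p h \<and> (\<forall>\<^sub>F x in nhds p. f x = h x) \<longrightarrow> v f = v h) \<and>
     (\<forall>f h. smooth_near \<A> p f \<and> smooth_near \<A> p h \<longrightarrow> v (\<lambda>x. f x + h x) = v f + v h) \<and>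
     (\<forall>c f. smooth_near \<A> p f \<longrightarrow> v (\<lambda>x. c * f x) = of_real c * v f) \<and>
     (\<forall>f h. smooth_near \<A> p f \<and> smooth_near \<A> p h \<longrightarrow>
        v (\<lambda>x. f x * h x) = v f * of_real (h p) + of_real (f p) * v h)"
  unfolding ctangent_def tangent_def re_vec_def im_vec_def complex_eq_iff
  by (simp add: all_conj_distrib imp_conjR conj_ac)

context smooth_manifold
begin

definition csmooth :: "'a set \<Rightarrow> ('a \<Rightarrow> complex) \<Rightarrow> bool" where
  "csmooth V h \<longleftrightarrow> smooth_fun \<A> V (\<lambda>x. Re (h x)) \<and> smooth_fun \<A> V (\<lambda>x. Im (h x))"

definition csmooth_near :: "'a \<Rightarrow> ('a \<Rightarrow> complex) \<Rightarrow> bool" where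
  "csmooth_near p h \<longleftrightarrow> smooth_near \<A> p (\<lambda>x. Re (h x)) \<and> smooth_near \<A> p (\<lambda>x. Im (h x))"

lemma csmooth_const: "csmooth V (\<lambda>x. c)"
  by (simp add: csmooth_def smooth_fun_const)

lemma csmooth_of_real: "smooth_fun \<A> V f \<Longrightarrow> csmooth V (\<lambda>x. of_real (f x))"
  by (simp add: csmooth_def smooth_fun_const)

lemma csmooth_add: "open V \<Longrightarrow> csmooth V f \<Longrightarrow> csmooth V h \<Longrightarrow> csmooth V (\<lambda>x. f x + h x)"
  by (simp add: csmooth_def smooth_fun_add)

lemma csmooth_diff: "open V \<Longrightarrow> csmooth V f \<Longrightarrow> csmooth V h \<Longrightarrow> csmooth V (\<lambda>x. f x - h x)"
  by (simp add: csmooth_def smooth_fun_diff)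

lemma csmooth_mult: "open V \<Longrightarrow> csmooth V f \<Longrightarrow> csmooth V h \<Longrightarrow> csmooth V (\<lambda>x. f x * h x)"
  by (simp add: csmooth_def smooth_fun_diff smooth_fun_add smooth_fun_mult)

lemma csmooth_cnj: "open V \<Longrightarrow> csmooth V f \<Longrightarrow> csmooth V (\<lambda>x. cnj (f x))"
  by (simp add: csmooth_def smooth_fun_uminus)

lemma csmooth_subset: "csmooth V f \<Longrightarrow> W \<subseteq> V \<Longrightarrow> csmooth W f"
  unfolding csmooth_def using smooth_fun_subset by blast

lemma csmooth_cong: "open V \<Longrightarrow> (\<And>x. x \<in> V \<Longrightarrow> f x = h x) \<Longrightarrow> csmooth V f \<Longrightarrow> csmooth V h"
  unfolding csmooth_def
  by (auto intro: smooth_fun_cong[of V "\<lambda>x. Re (f x)"] smooth_fun_cong[of V "\<lambda>x. Im (f x)"])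

lemma csmooth_near_iff: "csmooth_near p f \<longleftrightarrow> (\<exists>V. open V \<and> p \<in> V \<and> csmooth V f)"
  unfolding csmooth_near_def csmooth_def
  by (metis smooth_near2 smooth_near_def)

lemma csmooth_near_const: "csmooth_near p (\<lambda>x. c)"
  by (simp add: csmooth_near_def smooth_near_const)

lemma csmooth_near_of_real: "smooth_near \<A> p f \<Longrightarrow> csmooth_near p (\<lambda>x. of_real (f x))"
  by (simp add: csmooth_near_def smooth_near_const)

lemma csmooth_near_add:
  "csmooth_near p f \<Longrightarrow> csmooth_near p h \<Longrightarrow> csmooth_near p (\<lambda>x. f x + h x)"
  by (simp add: csmooth_near_def smooth_near_add)

lemma csmooth_near_mult:
  "csmooth_near p f \<Longrightarrow> csmooth_near p h \<Longrightarrow> csmooth_near p (\<lambda>x. f x * h x)"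
  by (simp add: csmooth_near_def smooth_near_diff smooth_near_add smooth_near_mult)

section \<open>Complex tangent vectors as derivations\<close>

lemma ctangent_outside: "ctangent \<A> p v \<Longrightarrow> \<not> smooth_near \<A> p f \<Longrightarrow> v f = 0"
  by (simp add: ctangent_iff)

text \<open>The germ condition in \<open>tangent\<close> speaks only of functions smooth near p. If
  f is not smooth near p then neither is h, and both values are the default 0.\<close>

lemma ctangent_cong:
  assumes "ctangent \<A> p v" "\<forall>\<^sub>F x in nhds p. f x = h x"
  shows "v f = v h"
proof (cases "smooth_near \<A> p f")
  case True
  then show ?thesis using assms smooth_near_cong[OF assms(2)] by (simp add: ctangent_iff)
next
  case False
  have "\<forall>\<^sub>F x in nhds p. h x = f x" using assms(2) by eventually_elim simp
  then have "\<not> smooth_near \<A> p h" using False smooth_near_cong by blast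
  then show ?thesis using False assms(1) by (simp add: ctangent_outside)
qed

lemma ctangent_plus_arg:
  "ctangent \<A> p v \<Longrightarrow> smooth_near \<A> p f \<Longrightarrow> smooth_near \<A> p h \<Longrightarrow>
    v (\<lambda>x. f x + h x) = v f + v h"
  by (simp add: ctangent_iff)

lemma ctangent_scale_arg:
  "ctangent \<A> p v \<Longrightarrow> smooth_near \<A> p f \<Longrightarrow> v (\<lambda>x. c * f x) = of_real c * v f"
  by (simp add: ctangent_iff)

lemma ctangent_mult_arg:
  "ctangent \<A> p v \<Longrightarrow> smooth_near \<A> p f \<Longrightarrow> smooth_near \<A> p h \<Longrightarrow>
    v (\<lambda>x. f x * h x) = v f * of_real (h p) + of_real (f p) * v h"
  by (simp add: ctangent_iff)

lemma ctangent_diff_arg: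
  assumes "ctangent \<A> p v" "smooth_near \<A> p f" "smooth_near \<A> p h"
  shows "v (\<lambda>x. f x - h x) = v f - v h"
  using ctangent_plus_arg[OF assms(1,2) smooth_near_uminus[OF assms(3)]]
    ctangent_scale_arg[OF assms(1,3), of "-1"] by simp

text \<open>The product rule for 1 = 1 * 1 doubles the value at 1, which is therefore 0; homogeneity
  gives the other constants.\<close>

lemma ctangent_const_arg:
  assumes "ctangent \<A> p v"
  shows "v (\<lambda>x. c) = 0"
proof -
  have "v (\<lambda>x. 1) = 0"
    using ctangent_mult_arg[OF assms smooth_near_const smooth_near_const, of 1 1] by simp
  then show ?thesis
    using ctangent_scale_arg[OF assms smooth_near_const, of c 1] by simp
qed

lemma ctangent_0: "ctangent \<A> p 0"
  by (simp add: ctangent_iff)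

lemma ctangent_add: "ctangent \<A> p v \<Longrightarrow> ctangent \<A> p w \<Longrightarrow> ctangent \<A> p (v + w)"
  unfolding ctangent_iff plus_fun_def by (simp add: algebra_simps) metis

lemma ctangent_cscale: "ctangent \<A> p v \<Longrightarrow> ctangent \<A> p (cscale c v)"
  unfolding ctangent_iff cscale_def by (simp add: algebra_simps)

lemma ctangent_diff:
  assumes "ctangent \<A> p v" "ctangent \<A> p w" shows "ctangent \<A> p (v - w)"
  using ctangent_add[OF assms(1) ctangent_cscale[OF assms(2), of "-1"]]
  by (simp add: cscale_def plus_fun_def fun_diff_def)

lemma ctangent_cnj: "ctangent \<A> p v \<Longrightarrow> ctangent \<A> p (\<lambda>f. cnj (v f))"
  unfolding ctangent_iff by simp

lemma ctangent_sum: "(\<And>i. i \<in> I \<Longrightarrow> ctangent \<A> p (v i)) \<Longrightarrow> ctangent \<A> p (\<Sum>i\<in>I. v i)"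
  by (induction I rule: infinite_finite_induct) (simp_all add: ctangent_0 ctangent_add)

lemma tangent_scale: "tangent \<A> p v \<Longrightarrow> tangent \<A> p (\<lambda>f. c * v f)"
  unfolding tangent_def by (simp add: algebra_simps)

lemma tangent_uminus: "tangent \<A> p v \<Longrightarrow> tangent \<A> p (\<lambda>f. - v f)"
  using tangent_scale[of p v "-1"] by simp

lemma tangent_add: "tangent \<A> p v \<Longrightarrow> tangent \<A> p w \<Longrightarrow> tangent \<A> p (v + w)"
  \<comment> \<open>Real vectors are embedded with imaginary part zero; the factor 0 in
    \<open>tangent_scale\<close> shows that this part is tangent.\<close>
  using ctangent_add[of p "\<lambda>f. of_real (v f)" "\<lambda>f. of_real (w f)"] tangent_scale[of p v 0]
  by (simp add: ctangent_def re_vec_def im_vec_def plus_fun_def)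

lemma tangent_diff: "tangent \<A> p v \<Longrightarrow> tangent \<A> p w \<Longrightarrow> tangent \<A> p (v - w)"
  using tangent_add[OF _ tangent_uminus, of p v w] by (simp add: plus_fun_def fun_diff_def)

lemma cderiv_of_real: "ctangent \<A> p (Z p) \<Longrightarrow> cderiv Z (\<lambda>x. of_real (f x)) p = Z p f"
  by (simp add: cderiv_def ctangent_const_arg[of p "Z p"])

lemma cderiv_const: "ctangent \<A> p (Z p) \<Longrightarrow> cderiv Z (\<lambda>x. c) p = 0"
  by (simp add: cderiv_def ctangent_const_arg[of p "Z p"])

lemma cderiv_cong:
  assumes "ctangent \<A> p (Z p)" "\<forall>\<^sub>F x in nhds p. f x = h x"
  shows "cderiv Z f p = cderiv Z h p"
proof -
  have "\<forall>\<^sub>F x in nhds p. Re (f x) = Re (h x)" "\<forall>\<^sub>F x in nhds p. Im (f x) = Im (h x)"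
    using assms(2) by (eventually_elim, simp)+
  then show ?thesis unfolding cderiv_def using ctangent_cong[OF assms(1)] by metis
qed

lemma cderiv_add:
  "ctangent \<A> p (Z p) \<Longrightarrow> csmooth_near p f \<Longrightarrow> csmooth_near p h \<Longrightarrow>
    cderiv Z (\<lambda>x. f x + h x) p = cderiv Z f p + cderiv Z h p"
  unfolding cderiv_def csmooth_near_def
  by (simp add: ctangent_plus_arg[of p "Z p"] distrib_left)

lemma cderiv_diff:
  "ctangent \<A> p (Z p) \<Longrightarrow> csmooth_near p f \<Longrightarrow> csmooth_near p h \<Longrightarrow>
    cderiv Z (\<lambda>x. f x - h x) p = cderiv Z f p - cderiv Z h p"
  unfolding cderiv_def csmooth_near_def
  by (simp add: ctangent_diff_arg[of p "Z p"] right_diff_distrib)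

lemma cderiv_mult:
  assumes "ctangent \<A> p (Z p)" "csmooth_near p f" "csmooth_near p h"
  shows "cderiv Z (\<lambda>x. f x * h x) p = cderiv Z f p * h p + f p * cderiv Z h p"
proof -
  have "h p = of_real (Re (h p)) + \<i> * of_real (Im (h p))" "f p = of_real (Re (f p)) + \<i> * of_real (Im (f p))"
    by (simp_all add: complex_eq)
  \<comment> \<open>The parts at p get names of their own, since rewriting \<open>h p\<close> by an
    expression in \<open>Re (h p)\<close> would loop.\<close>
  then obtain a b c d where eq: "h p = of_real a + \<i> * of_real b" "f p = of_real c + \<i> * of_real d"
    and [simp]: "Re (h p) = a" "Im (h p) = b" "Re (f p) = c" "Im (f p) = d" by blast
  have *: "\<i> * (\<i> * z) = - z" for z by (simp flip: mult.assoc)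
  show ?thesis
    unfolding cderiv_def
    using assms by (simp add: csmooth_near_def ctangent_plus_arg[of p "Z p"] ctangent_diff_arg[of p "Z p"] ctangent_mult_arg[of p "Z p"]
        smooth_near_mult eq algebra_simps *)
qed

text \<open>Closure rules for complex fields can now be proved once instead of for both
  parts.\<close>

lemma cvector_field_iff:
  "cvector_field \<A> U Z \<longleftrightarrow> (\<forall>p\<in>U. ctangent \<A> p (Z p)) \<and>
    (\<forall>V f. open V \<and> V \<subseteq> U \<and> smooth_fun \<A> V f \<longrightarrow> csmooth V (\<lambda>p. Z p f))"
  unfolding cvector_field_def vector_field_def ctangent_def csmooth_def re_field_def im_field_def
    re_vec_def im_vec_def by (simp add: ball_conj_distrib all_conj_distrib imp_conjR conj_ac)

end

section \<open>Complex vector fields on an open set and their Lie bracket\<close>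

locale smooth_domain = smooth_manifold \<A>
  for \<A> :: "('a::{t2_space, second_countable_topology}, 'e::euclidean_space) atlas" +
  fixes U :: "'a set"
  assumes open_U: "open U"
begin

abbreviation cvf :: "'a cfield \<Rightarrow> bool" where "cvf \<equiv> cvector_field \<A> U"

abbreviation cbr :: "'a cfield \<Rightarrow> 'a cfield \<Rightarrow> 'a cfield" where "cbr \<equiv> cext_op (lie_bracket \<A>)"

lemma eventually_U: "p \<in> U \<Longrightarrow> (\<And>q. q \<in> U \<Longrightarrow> P q) \<Longrightarrow> \<forall>\<^sub>F q in nhds p. P q"
  using open_U eventually_nhds by blast

lemma cvf_ctangent: "cvf Z \<Longrightarrow> p \<in> U \<Longrightarrow> ctangent \<A> p (Z p)"
  by (simp add: cvector_field_iff)

lemma cvf_csmooth: "cvf Z \<Longrightarrow> open V \<Longrightarrow> V \<subseteq> U \<Longrightarrow> smooth_fun \<A> V f \<Longrightarrow> csmooth V (\<lambda>p. Z p f)"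
  by (simp add: cvector_field_iff)

lemma csmooth_cderiv:
  assumes "cvf Z" "open V" "V \<subseteq> U" "csmooth V h"
  shows "csmooth V (cderiv Z h)"
  unfolding cderiv_def using assms(4)
  by (intro csmooth_add csmooth_mult csmooth_const cvf_csmooth[OF assms(1-3)] assms(2))
    (simp_all add: csmooth_def)

lemma csmooth_near_field:
  assumes "cvf Z" "p \<in> U" "smooth_near \<A> p f"
  shows "csmooth_near p (\<lambda>q. Z q f)"
proof -
  obtain V where V: "open V" "p \<in> V" "smooth_fun \<A> V f"
    using assms(3) unfolding smooth_near_def by auto
  then have "csmooth (V \<inter> U) (\<lambda>q. Z q f)"
    using open_U smooth_fun_subset[of V f "V \<inter> U"] by (intro cvf_csmooth[OF assms(1)]) auto
  then show ?thesis unfolding csmooth_near_iff using V assms(2) open_U by (metis IntI open_Int)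
qed

lemma csmooth_near_cderiv:
  assumes "cvf Z" "p \<in> U" "csmooth_near p h"
  shows "csmooth_near p (cderiv Z h)"
  unfolding cderiv_def using assms(3)
  by (intro csmooth_near_add csmooth_near_mult csmooth_near_const csmooth_near_field[OF assms(1,2)])
    (simp_all add: csmooth_near_def)

lemma csmooth_imp_near: "csmooth U h \<Longrightarrow> p \<in> U \<Longrightarrow> csmooth_near p h"
  using open_U csmooth_near_iff by blast

lemma cvf_0: "cvf 0"
  by (simp add: cvector_field_iff ctangent_0 csmooth_const)

lemma cvf_add: "cvf X \<Longrightarrow> cvf Y \<Longrightarrow> cvf (X + Y)"
  unfolding cvector_field_iff by (auto intro: ctangent_add csmooth_add)

lemma cvf_diff: "cvf X \<Longrightarrow> cvf Y \<Longrightarrow> cvf (X - Y)"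
  unfolding cvector_field_iff by (auto intro: ctangent_diff csmooth_diff)

lemma cvf_cmul: "csmooth U h \<Longrightarrow> cvf X \<Longrightarrow> cvf (cmul h X)"
  unfolding cvector_field_iff cmul_def
  by (auto intro!: ctangent_cscale) (auto simp: cscale_def intro!: csmooth_mult elim: csmooth_subset)

lemma cvf_cnj: "cvf X \<Longrightarrow> cvf (cnj_field X)"
  unfolding cvector_field_iff cnj_field_def by (auto intro: ctangent_cnj csmooth_cnj)

lemma cvf_sum: "(\<And>i. i \<in> I \<Longrightarrow> cvf (X i)) \<Longrightarrow> cvf (\<Sum>i\<in>I. X i)"
  by (induction I rule: infinite_finite_induct) (simp_all add: cvf_0 cvf_add)

text \<open>The four real brackets collect to the commutator of the complex derivations;
  \<open>cderiv\<close> enters because \<open>Y q f\<close> is complex valued.\<close>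

lemma cbr_apply:
  "cbr X Y p f = (if smooth_near \<A> p f
     then cderiv X (\<lambda>q. Y q f) p - cderiv Y (\<lambda>q. X q f) p else 0)"
  by (simp add: cext_op_def lie_bracket_def cpx_vec_def cderiv_def re_field_def im_field_def
      re_vec_def im_vec_def complex_eq_iff)

lemma cbr_antisym: "cbr X Y = - cbr Y X"
  by (auto simp: fun_eq_iff cbr_apply)

text \<open>The commutator formula for complex valued h follows from the real one by splitting h
  into its parts. Fields applied to functions and values of the metric are complex, so the Jacobi
  identity and the skewness of the curvature need this form.\<close>

lemma cderiv_cbr:
  assumes "cvf X" "cvf Y" "p \<in> U" "csmooth_near p h"
  shows "cderiv (cbr X Y) h p = cderiv X (cderiv Y h) p - cderiv Y (cderiv X h) p"
proof -
  have h: "smooth_near \<A> p (\<lambda>x. Re (h x))" "smooth_near \<A> p (\<lambda>x. Im (h x))"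
    using assms(4) by (simp_all add: csmooth_near_def)
  have *: "cderiv X (cderiv Y h) p =
    cderiv X (\<lambda>q. Y q (\<lambda>x. Re (h x))) p + \<i> * cderiv X (\<lambda>q. Y q (\<lambda>x. Im (h x))) p"
    if "cvf X" "cvf Y" for X Y
    unfolding cderiv_def[of Y]
    using cvf_ctangent[OF that(1) assms(3)] csmooth_near_field[OF that(2) assms(3)] h
    by (simp add: cderiv_add cderiv_mult cderiv_const csmooth_near_mult csmooth_near_const)
  show ?thesis
    by (simp add: * assms(1,2) cderiv_def[of "cbr X Y"] cbr_apply h algebra_simps)
qed

text \<open>In the product rule the mixed terms X f * Y h + Y f * X h are symmetric in X and Y, so
  the commutator cancels them.\<close>

lemma ctangent_cbr:
  assumes "cvf X" "cvf Y" "p \<in> U"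
  shows "ctangent \<A> p (cbr X Y p)"
proof -
  have eq: "cbr X Y p f = cderiv X (\<lambda>q. Y q f) p - cderiv Y (\<lambda>q. X q f) p" if "smooth_near \<A> p f" for f
    using that by (simp add: cbr_apply)
  note T = cvf_ctangent[OF assms(1,3)] cvf_ctangent[OF assms(2,3)]
  note N = csmooth_near_field[OF assms(1,3)] csmooth_near_field[OF assms(2,3)]
  \<comment> \<open>The rules for a tangent vector at q require smoothness near q, which is
    therefore secured for all q near p.\<close>
  have ev: "\<forall>\<^sub>F q in nhds p. q \<in> U \<and> smooth_near \<A> q f \<and> smooth_near \<A> q h"
    if "smooth_near \<A> p f" "smooth_near \<A> p h" for f h
    using eventually_smooth_near[OF that(1)] eventually_smooth_near[OF that(2)] eventually_U[OF assms(3), of "\<lambda>q. q \<in> U"]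
    by (auto elim: eventually_elim2 intro: eventually_conj)
  show ?thesis
    unfolding ctangent_iff
  proof (intro conjI allI impI; (elim conjE)?)
    fix f assume "\<not> smooth_near \<A> p f"
    then show "cbr X Y p f = 0" by (simp add: cbr_apply)
  next
    fix f h assume s: "smooth_near \<A> p f" "smooth_near \<A> p h" and e: "\<forall>\<^sub>F x in nhds p. f x = h x"
    have "\<forall>\<^sub>F q in nhds p. Z q f = Z q h" if "cvf Z" for Z
      \<comment> \<open>The germs have to agree at every q near p, not only at p: hence the nested
        neighbourhood statement.\<close>
      using ev[OF s] eventually_eventually[THEN iffD2, OF e]
      by eventually_elim (use that cvf_ctangent ctangent_cong in blast)
    then show "cbr X Y p f = cbr X Y p h"
      using eq s assms cderiv_cong[where Z = X, OF T(1)] cderiv_cong[where Z = Y, OF T(2)] by metis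
  next
    fix f h assume s: "smooth_near \<A> p f" "smooth_near \<A> p h"
    have *: "\<forall>\<^sub>F q in nhds p. Z q (\<lambda>x. f x + h x) = Z q f + Z q h" if "cvf Z" for Z
      using ev[OF s] by eventually_elim (use that cvf_ctangent ctangent_plus_arg in blast)
    show "cbr X Y p (\<lambda>x. f x + h x) = cbr X Y p f + cbr X Y p h"
      using s N T by (simp add: eq smooth_near_add cderiv_cong[where Z = X, OF T(1) *] cderiv_cong[where Z = Y, OF T(2) *] assms cderiv_add)
    have *: "\<forall>\<^sub>F q in nhds p. Z q (\<lambda>x. f x * h x) = Z q f * of_real (h q) + of_real (f q) * Z q h" if "cvf Z" for Z
      using ev[OF s] by eventually_elim (use that cvf_ctangent ctangent_mult_arg in blast)
    show "cbr X Y p (\<lambda>x. f x * h x) = cbr X Y p f * of_real (h p) + of_real (f p) * cbr X Y p h"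
      using s N T csmooth_near_of_real[OF s(1)] csmooth_near_of_real[OF s(2)]
      by (simp add: eq smooth_near_mult cderiv_cong[where Z = X, OF T(1) *] cderiv_cong[where Z = Y, OF T(2) *] assms cderiv_add
          cderiv_mult csmooth_near_mult cderiv_of_real algebra_simps)
  next
    fix f and c :: real assume s: "smooth_near \<A> p f"
    have *: "\<forall>\<^sub>F q in nhds p. Z q (\<lambda>x. c * f x) = of_real c * Z q f" if "cvf Z" for Z
      using ev[OF s s] by eventually_elim (use that cvf_ctangent ctangent_scale_arg in blast)
    show "cbr X Y p (\<lambda>x. c * f x) = of_real c * cbr X Y p f"
      using s N T smooth_near_mult[OF smooth_near_const s, of c]
      by (simp add: eq cderiv_cong[where Z = X, OF T(1) *] cderiv_cong[where Z = Y, OF T(2) *] assms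
          cderiv_mult cderiv_const csmooth_near_const algebra_simps)
  qed
qed

lemma cvf_cbr:
  assumes "cvf X" "cvf Y" shows "cvf (cbr X Y)"
  unfolding cvector_field_iff
proof (intro conjI ballI allI impI; (elim conjE)?)
  fix V f assume V: "open V" "V \<subseteq> U" "smooth_fun \<A> V f"
  have "csmooth V (\<lambda>p. cderiv X (\<lambda>q. Y q f) p - cderiv Y (\<lambda>q. X q f) p)"
    using V assms by (intro csmooth_diff csmooth_cderiv cvf_csmooth) auto
  then show "csmooth V (\<lambda>p. cbr X Y p f)"
    \<comment> \<open>On V the function f is smooth near every point, so the default 0 of the
      bracket does not occur.\<close>
    by (rule csmooth_cong[rotated 2]) (use V in \<open>auto simp: cbr_apply smooth_near_def\<close>)
qed (use assms in \<open>auto intro: ctangent_cbr\<close>)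

lemma cderiv_field_cong: "X p = X' p \<Longrightarrow> cderiv X h p = cderiv X' h p"
  by (simp add: cderiv_def)

text \<open>The bracket differentiates both fields, so agreement on the open set U is assumed, not
  only at p.\<close>

lemma cbr_cong:
  assumes "cvf X" "cvf Y" "p \<in> U" "\<And>q. q \<in> U \<Longrightarrow> X q = X' q" "\<And>q. q \<in> U \<Longrightarrow> Y q = Y' q"
  shows "cbr X Y p = cbr X' Y' p"
proof
  fix f
  have "cderiv X (\<lambda>q. Y q f) p = cderiv X' (\<lambda>q. Y' q f) p"
    using cderiv_cong[where Z = X and f = "\<lambda>q. Y q f" and h = "\<lambda>q. Y' q f", OF cvf_ctangent[OF assms(1,3)] eventually_U[OF assms(3)]] assms(5)
      cderiv_field_cong[where X = X and X' = X' and p = p] assms(3,4) by simp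
  moreover have "cderiv Y (\<lambda>q. X q f) p = cderiv Y' (\<lambda>q. X' q f) p"
    using cderiv_cong[where Z = Y and f = "\<lambda>q. X q f" and h = "\<lambda>q. X' q f", OF cvf_ctangent[OF assms(2,3)] eventually_U[OF assms(3)]] assms(4)
      cderiv_field_cong[where X = Y and X' = Y' and p = p] assms(3,5) by simp
  ultimately show "cbr X Y p f = cbr X' Y' p f" by (simp add: cbr_apply)
qed

lemma cbr_add_left:
  assumes "cvf X" "cvf X'" "cvf Y" "p \<in> U"
  shows "cbr (X + X') Y p = cbr X Y p + cbr X' Y p"
proof
  fix f
  have "cderiv (X + X') h p = cderiv X h p + cderiv X' h p" for h
    by (simp add: cderiv_def algebra_simps)
  moreover have "smooth_near \<A> p f \<Longrightarrow>
      cderiv Y (\<lambda>q. (X + X') q f) p = cderiv Y (\<lambda>q. X q f) p + cderiv Y (\<lambda>q. X' q f) p"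
    using cderiv_add[where Z = Y, OF cvf_ctangent[OF assms(3,4)] csmooth_near_field[OF assms(1,4)] csmooth_near_field[OF assms(2,4)]]
    by simp
  ultimately show "cbr (X + X') Y p f = (cbr X Y p + cbr X' Y p) f"
    by (simp add: cbr_apply)
qed

lemma cbr_cmul_left:
  assumes "csmooth U h" "cvf X" "cvf Y" "p \<in> U"
  shows "cbr (cmul h X) Y p = cscale (h p) (cbr X Y p) - cscale (cderiv Y h p) (X p)"
proof
  fix f
  have "cderiv (cmul h X) k p = h p * cderiv X k p" for k
    by (simp add: cderiv_def cmul_def cscale_def algebra_simps)
  moreover have "smooth_near \<A> p f \<Longrightarrow>
      cderiv Y (\<lambda>q. cmul h X q f) p = cderiv Y h p * X p f + h p * cderiv Y (\<lambda>q. X q f) p"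
    using cderiv_mult[where Z = Y, OF cvf_ctangent[OF assms(3,4)] csmooth_imp_near[OF assms(1,4)] csmooth_near_field[OF assms(2,4)]]
    by (simp add: cmul_def cscale_def)
  \<comment> \<open>For functions not smooth near p the bracket has the default 0, so the extra term
    in \<open>X p f\<close> must vanish there too.\<close>
  moreover have "\<not> smooth_near \<A> p f \<Longrightarrow> X p f = 0"
    using cvf_ctangent[OF assms(2,4)] ctangent_outside by blast
  ultimately show "cbr (cmul h X) Y p f = (cscale (h p) (cbr X Y p) - cscale (cderiv Y h p) (X p)) f"
    by (simp add: cbr_apply cscale_def algebra_simps)
qed

text \<open>Each double bracket becomes four threefold derivatives of f, and the twelve terms of the
  cyclic sum cancel in pairs.\<close>

lemma cbr_jacobi:
  assumes "cvf X" "cvf Y" "cvf Z" "p \<in> U"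
  shows "cbr (cbr X Y) Z p + cbr (cbr Y Z) X p + cbr (cbr Z X) Y p = 0"
proof
  fix f
  show "(cbr (cbr X Y) Z p + cbr (cbr Y Z) X p + cbr (cbr Z X) Y p) f = 0 f"
  proof (cases "smooth_near \<A> p f")
    case True
    have *: "cbr (cbr A B) C p f =
        cderiv A (cderiv B (\<lambda>q. C q f)) p - cderiv B (cderiv A (\<lambda>q. C q f)) p
        - cderiv C (cderiv A (\<lambda>q. B q f)) p + cderiv C (cderiv B (\<lambda>q. A q f)) p"
      if "cvf A" "cvf B" "cvf C" for A B C
    proof -
      have "\<forall>\<^sub>F q in nhds p. cbr A B q f = cderiv A (\<lambda>q. B q f) q - cderiv B (\<lambda>q. A q f) q"
        using eventually_smooth_near[OF True] by eventually_elim (simp add: cbr_apply)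
      then have "cderiv C (\<lambda>q. cbr A B q f) p =
          cderiv C (\<lambda>q. cderiv A (\<lambda>q. B q f) q - cderiv B (\<lambda>q. A q f) q) p"
        by (rule cderiv_cong[where Z = C, OF cvf_ctangent[OF that(3) assms(4)]])
      also have "\<dots> = cderiv C (cderiv A (\<lambda>q. B q f)) p - cderiv C (cderiv B (\<lambda>q. A q f)) p"
        using that True assms(4)
        by (intro cderiv_diff csmooth_near_cderiv csmooth_near_field cvf_ctangent)
      finally show ?thesis
        using True that assms(4) by (simp add: cbr_apply[of "cbr A B"] cderiv_cbr csmooth_near_field)
    qed
    show ?thesis by (simp add: * assms)
  qed (simp add: cbr_apply)
qed

end

section \<open>Connections, torsion and curvature\<close>

lemma diff_eq_fmul: "X - Y = X + fmul (\<lambda>_. - 1) (Y :: 'a rfield)"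
  by (simp add: fun_eq_iff fmul_def)

lemma re_field_cext_op: "re_field (cext_op B X Y) = B (re_field X) (re_field Y) - B (im_field X) (im_field Y)"
  and im_field_cext_op: "im_field (cext_op B X Y) = B (re_field X) (im_field Y) + B (im_field X) (re_field Y)"
  by (simp_all add: fun_eq_iff cext_op_def cpx_vec_def re_field_def im_field_def re_vec_def im_vec_def)

lemma re_field_add: "re_field (X + Y) = re_field X + re_field Y"
  and im_field_add: "im_field (X + Y) = im_field X + im_field Y"
  and re_field_cmul: "re_field (cmul h X) = fmul (\<lambda>p. Re (h p)) (re_field X) - fmul (\<lambda>p. Im (h p)) (im_field X)"
  and im_field_cmul: "im_field (cmul h X) = fmul (\<lambda>p. Re (h p)) (im_field X) + fmul (\<lambda>p. Im (h p)) (re_field X)"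
  by (simp_all add: fun_eq_iff re_field_def im_field_def re_vec_def im_vec_def cmul_def cscale_def fmul_def)

lemma cext_op_apply: "cext_op B X Y p f = Complex
    (B (re_field X) (re_field Y) p f - B (im_field X) (im_field Y) p f)
    (B (re_field X) (im_field Y) p f + B (im_field X) (re_field Y) p f)"
  by (simp add: cext_op_def cpx_vec_def)

context smooth_domain
begin

abbreviation vf :: "'a rfield \<Rightarrow> bool" where "vf \<equiv> vector_field \<A> U"

lemma vf_0: "vf 0"
proof -
  have "re_field (0 :: 'a cfield) = 0" by (simp add: fun_eq_iff re_field_def re_vec_def)
  then show ?thesis using cvf_0 unfolding cvector_field_def by metis
qed

text \<open>This goes back from complex to real fields: a real field is a complex one with imaginary
  part zero, so the real closure rules are read off from the complex ones.\<close>

lemma vf_iff_cvf: "vf X \<longleftrightarrow> cvf (\<lambda>p f. complex_of_real (X p f))"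
proof -
  have "re_field (\<lambda>p f. complex_of_real (X p f)) = X" "im_field (\<lambda>p f. complex_of_real (X p f)) = 0"
    by (simp_all add: fun_eq_iff re_field_def im_field_def re_vec_def im_vec_def)
  then show ?thesis by (simp add: cvector_field_def vf_0)
qed

lemma vf_add: "vf X \<Longrightarrow> vf Y \<Longrightarrow> vf (X + Y)"
  using cvf_add[of "\<lambda>p f. complex_of_real (X p f)" "\<lambda>p f. complex_of_real (Y p f)"]
  by (simp add: vf_iff_cvf plus_fun_def)

lemma vf_diff: "vf X \<Longrightarrow> vf Y \<Longrightarrow> vf (X - Y)"
  using cvf_diff[of "\<lambda>p f. complex_of_real (X p f)" "\<lambda>p f. complex_of_real (Y p f)"]
  by (simp add: vf_iff_cvf fun_diff_def)

lemma vf_fmul: "smooth_fun \<A> U h \<Longrightarrow> vf X \<Longrightarrow> vf (fmul h X)"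
  using cvf_cmul[OF csmooth_of_real, of h "\<lambda>p f. complex_of_real (X p f)"]
  by (simp add: vf_iff_cvf cmul_def cscale_def fmul_def)

lemma cvf_vf: "cvf X \<Longrightarrow> vf (re_field X)" "cvf X \<Longrightarrow> vf (im_field X)"
  by (simp_all add: cvector_field_def)

lemma vf_const_arg: "vf X \<Longrightarrow> p \<in> U \<Longrightarrow> X p (\<lambda>x. c) = 0"
  using ctangent_const_arg[OF cvf_ctangent] by (fastforce simp: vf_iff_cvf)

lemma cvf_cong:
  assumes "cvf X" "\<And>q. q \<in> U \<Longrightarrow> X q = X' q" shows "cvf X'"
  unfolding cvector_field_iff
proof (intro conjI ballI allI impI; (elim conjE)?)
  fix p assume "p \<in> U"
  then show "ctangent \<A> p (X' p)" using cvf_ctangent[OF assms(1)] assms(2) by metis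
next
  fix V f assume V: "open V" "V \<subseteq> U" "smooth_fun \<A> V f"
  show "csmooth V (\<lambda>p. X' p f)"
    by (rule csmooth_cong[OF V(1) _ cvf_csmooth[OF assms(1) V]]) (use V assms(2) in \<open>metis subsetD\<close>)
qed

end

section \<open>The complex linear extension of a connection\<close>

locale connection_domain = smooth_domain \<A> U
  for \<A> :: "('a::{t2_space, second_countable_topology}, 'e::euclidean_space) atlas" and U +
  fixes D :: "'a rfield \<Rightarrow> 'a rfield \<Rightarrow> 'a rfield"
  assumes connection: "connection \<A> D"
begin

abbreviation nab :: "'a cfield \<Rightarrow> 'a cfield \<Rightarrow> 'a cfield" where "nab \<equiv> cext_op D"
abbreviation tor :: "'a cfield \<Rightarrow> 'a cfield \<Rightarrow> 'a cfield" where "tor \<equiv> torsion \<A> D"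
abbreviation curv :: "'a cfield \<Rightarrow> 'a cfield \<Rightarrow> 'a cfield \<Rightarrow> 'a cfield" where "curv \<equiv> curvature \<A> D"

lemma connection_rules:
  shows vf_D: "vf X \<Longrightarrow> vf Y \<Longrightarrow> vf (D X Y)"
    and D_add_left: "vf X \<Longrightarrow> vf X' \<Longrightarrow> vf Y \<Longrightarrow> p \<in> U \<Longrightarrow> D (X + X') Y p = D X Y p + D X' Y p"
    and D_fmul_left: "smooth_fun \<A> U f \<Longrightarrow> vf X \<Longrightarrow> vf Y \<Longrightarrow> p \<in> U \<Longrightarrow> D (fmul f X) Y p = fmul f (D X Y) p"
    and D_add_right: "vf X \<Longrightarrow> vf Y \<Longrightarrow> vf Y' \<Longrightarrow> p \<in> U \<Longrightarrow> D X (Y + Y') p = D X Y p + D X Y' p"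
    and D_fmul_right: "smooth_fun \<A> U f \<Longrightarrow> vf X \<Longrightarrow> vf Y \<Longrightarrow> p \<in> U \<Longrightarrow>
      D X (fmul f Y) p = fmul (\<lambda>q. X q f) Y p + fmul f (D X Y) p"
    and D_cong: "vf X \<Longrightarrow> vf Y \<Longrightarrow> vf X' \<Longrightarrow> vf Y' \<Longrightarrow> (\<And>p. p \<in> U \<Longrightarrow> X p = X' p) \<Longrightarrow>
      (\<And>p. p \<in> U \<Longrightarrow> Y p = Y' p) \<Longrightarrow> p \<in> U \<Longrightarrow> D X Y p = D X' Y' p"
proof -
  note c = connection[unfolded connection_def, THEN spec, THEN mp, OF open_U]
  show "vf X \<Longrightarrow> vf Y \<Longrightarrow> vf (D X Y)"
    using c[THEN conjunct1] by blast
  show "vf X \<Longrightarrow> vf X' \<Longrightarrow> vf Y \<Longrightarrow> p \<in> U \<Longrightarrow> D (X + X') Y p = D X Y p + D X' Y p"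
    using c[THEN conjunct2, THEN conjunct1] by blast
  show "smooth_fun \<A> U f \<Longrightarrow> vf X \<Longrightarrow> vf Y \<Longrightarrow> p \<in> U \<Longrightarrow> D (fmul f X) Y p = fmul f (D X Y) p"
    using c[THEN conjunct2, THEN conjunct2, THEN conjunct1] by blast
  show "vf X \<Longrightarrow> vf Y \<Longrightarrow> vf Y' \<Longrightarrow> p \<in> U \<Longrightarrow> D X (Y + Y') p = D X Y p + D X Y' p"
    using c[THEN conjunct2, THEN conjunct2, THEN conjunct2, THEN conjunct1] by blast
  show "smooth_fun \<A> U f \<Longrightarrow> vf X \<Longrightarrow> vf Y \<Longrightarrow> p \<in> U \<Longrightarrow>
      D X (fmul f Y) p = fmul (\<lambda>q. X q f) Y p + fmul f (D X Y) p"
    using c[THEN conjunct2, THEN conjunct2, THEN conjunct2, THEN conjunct2, THEN conjunct1] by blast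
  show "vf X \<Longrightarrow> vf Y \<Longrightarrow> vf X' \<Longrightarrow> vf Y' \<Longrightarrow> (\<And>p. p \<in> U \<Longrightarrow> X p = X' p) \<Longrightarrow>
      (\<And>p. p \<in> U \<Longrightarrow> Y p = Y' p) \<Longrightarrow> p \<in> U \<Longrightarrow> D X Y p = D X' Y' p"
    using c[THEN conjunct2, THEN conjunct2, THEN conjunct2, THEN conjunct2, THEN conjunct2,
      THEN spec[of _ X], THEN spec[of _ X'], THEN spec[of _ Y], THEN spec[of _ Y']] by blast
qed

lemma D_diff_left:
  assumes "vf X" "vf X'" "vf Y" "p \<in> U" shows "D (X - X') Y p = D X Y p - D X' Y p"
  unfolding diff_eq_fmul using assms
  by (simp add: D_add_left D_fmul_left vf_fmul smooth_fun_const) (simp add: fmul_def fun_eq_iff)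

text \<open>The constant factor -1 leaves, through the Leibniz rule, the derivative of a constant;
  \<open>vf_const_arg\<close> removes it.\<close>

lemma D_diff_right:
  assumes "vf X" "vf Y" "vf Y'" "p \<in> U" shows "D X (Y - Y') p = D X Y p - D X Y' p"
  unfolding diff_eq_fmul using assms
  by (simp add: D_add_right D_fmul_right vf_fmul smooth_fun_const)
    (simp add: fmul_def fun_eq_iff vf_const_arg)

lemma cvf_nab: "cvf X \<Longrightarrow> cvf Y \<Longrightarrow> cvf (nab X Y)"
  unfolding cvector_field_def re_field_cext_op im_field_cext_op
  by (auto intro: vf_add vf_diff vf_D)

text \<open>The last clause of \<open>connection\<close> is applied to the four pairings of real and
  imaginary parts. This rule carries an identity known only on U under an outer
  \<open>nab\<close>.\<close>

lemma nab_cong: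
  assumes "cvf X" "cvf Y" "\<And>q. q \<in> U \<Longrightarrow> X q = X' q" "\<And>q. q \<in> U \<Longrightarrow> Y q = Y' q" "p \<in> U"
  shows "nab X Y p = nab X' Y' p"
proof -
  have XY: "cvf X'" "cvf Y'" using assms cvf_cong by blast+
  have eq: "re_field X q = re_field X' q" "im_field X q = im_field X' q"
    "re_field Y q = re_field Y' q" "im_field Y q = im_field Y' q" if "q \<in> U" for q
    using that assms(3,4) by (simp_all add: re_field_def im_field_def)
  have "D (re_field X) (re_field Y) p = D (re_field X') (re_field Y') p"
    "D (im_field X) (im_field Y) p = D (im_field X') (im_field Y') p"
    "D (re_field X) (im_field Y) p = D (re_field X') (im_field Y') p"
    "D (im_field X) (re_field Y) p = D (im_field X') (re_field Y') p"
    by (rule D_cong; simp add: cvf_vf assms(1,2,5) XY eq)+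
  then show ?thesis by (simp add: fun_eq_iff cext_op_apply)
qed

lemma nab_add_left:
  "cvf X \<Longrightarrow> cvf X' \<Longrightarrow> cvf Y \<Longrightarrow> p \<in> U \<Longrightarrow> nab (X + X') Y p = nab X Y p + nab X' Y p"
  by (rule ext) (simp add: cext_op_apply re_field_add im_field_add D_add_left cvf_vf complex_eq_iff)

lemma nab_add_right:
  "cvf X \<Longrightarrow> cvf Y \<Longrightarrow> cvf Y' \<Longrightarrow> p \<in> U \<Longrightarrow> nab X (Y + Y') p = nab X Y p + nab X Y' p"
  by (rule ext) (simp add: cext_op_apply re_field_add im_field_add D_add_right cvf_vf complex_eq_iff)

lemma nab_cmul_left:
  assumes "csmooth U h" "cvf X" "cvf Y" "p \<in> U"
  shows "nab (cmul h X) Y p = cscale (h p) (nab X Y p)"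
proof -
  have h: "smooth_fun \<A> U (\<lambda>p. Re (h p))" "smooth_fun \<A> U (\<lambda>p. Im (h p))"
    using assms(1) by (simp_all add: csmooth_def)
  show ?thesis
    by (rule ext) (simp add: cext_op_apply re_field_cmul im_field_cmul D_diff_left D_add_left D_fmul_left
      vf_fmul h cvf_vf assms complex_eq_iff, simp add: fmul_def cscale_def cext_op_apply algebra_simps)
qed

lemma nab_cmul_right:
  assumes "csmooth U h" "cvf X" "cvf Y" "p \<in> U"
  shows "nab X (cmul h Y) p = cscale (cderiv X h p) (Y p) + cscale (h p) (nab X Y p)"
proof -
  have h: "smooth_fun \<A> U (\<lambda>p. Re (h p))" "smooth_fun \<A> U (\<lambda>p. Im (h p))"
    using assms(1) by (simp_all add: csmooth_def)
  show ?thesis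
    by (rule ext) (simp add: cext_op_apply re_field_cmul im_field_cmul D_diff_right D_add_right D_fmul_right
      vf_fmul h cvf_vf assms complex_eq_iff, simp add: fmul_def cscale_def cext_op_apply cderiv_def
      re_field_def im_field_def re_vec_def im_vec_def algebra_simps)
qed

lemma nab_uminus_left: "cvf X \<Longrightarrow> cvf Y \<Longrightarrow> p \<in> U \<Longrightarrow> nab (- X) Y p = - nab X Y p"
  unfolding cuminus_eq_cmul by (simp add: nab_cmul_left csmooth_const)

lemma nab_diff_left:
  "cvf X \<Longrightarrow> cvf X' \<Longrightarrow> cvf Y \<Longrightarrow> p \<in> U \<Longrightarrow> nab (X - X') Y p = nab X Y p - nab X' Y p"
  unfolding cdiff_eq_cmul by (simp add: nab_add_left nab_cmul_left csmooth_const cvf_cmul)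

lemma nab_diff_right:
  "cvf X \<Longrightarrow> cvf Y \<Longrightarrow> cvf Y' \<Longrightarrow> p \<in> U \<Longrightarrow> nab X (Y - Y') p = nab X Y p - nab X Y' p"
  unfolding cdiff_eq_cmul
  by (simp add: nab_add_right nab_cmul_right csmooth_const cvf_cmul cderiv_const[where p = p and Z = X] cvf_ctangent)

lemma nab_0_left: "cvf Y \<Longrightarrow> p \<in> U \<Longrightarrow> nab 0 Y p = 0"
  by (subst czero_eq_cmul) (simp add: nab_cmul_left csmooth_const cvf_0)

lemma nab_0_right: "cvf X \<Longrightarrow> p \<in> U \<Longrightarrow> nab X 0 p = 0"
  by (subst czero_eq_cmul)
    (simp add: nab_cmul_right csmooth_const cvf_0 cderiv_const[where p = p and Z = X] cvf_ctangent)

lemma nab_uminus_right: "cvf X \<Longrightarrow> cvf Y \<Longrightarrow> p \<in> U \<Longrightarrow> nab X (- Y) p = - nab X Y p"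
  using nab_diff_right[of X 0 Y p] by (simp add: cvf_0 nab_0_right)

section \<open>Linearity of torsion and curvature over functions\<close>

lemma cvf_tor: "cvf X \<Longrightarrow> cvf Y \<Longrightarrow> cvf (tor X Y)"
  unfolding torsion_def by (intro cvf_diff cvf_nab cvf_cbr)

lemma cvf_curv: "cvf X \<Longrightarrow> cvf Y \<Longrightarrow> cvf Z \<Longrightarrow> cvf (curv X Y Z)"
  unfolding curvature_def by (intro cvf_diff cvf_nab cvf_cbr)

lemma tor_antisym: "tor X Y = - tor Y X"
  unfolding torsion_def by (subst cbr_antisym) simp

text \<open>Negating the bracket inside \<open>nab\<close> uses linearity of the connection, so this
  is asserted only on U, unlike \<open>tor_antisym\<close>.\<close>

lemma curv_antisym:
  assumes "cvf X" "cvf Y" "cvf Z" "p \<in> U"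
  shows "curv X Y Z p = - curv Y X Z p"
  using nab_uminus_left[OF cvf_cbr[OF assms(1,2)] assms(3,4)]
  by (simp add: curvature_def cbr_antisym[of Y X])

lemma tor_cong:
  assumes "cvf X" "cvf Y" "\<And>q. q \<in> U \<Longrightarrow> X q = X' q" "\<And>q. q \<in> U \<Longrightarrow> Y q = Y' q" "p \<in> U"
  shows "tor X Y p = tor X' Y' p"
  unfolding torsion_def
  using nab_cong[OF assms(1-5)] nab_cong[OF assms(2,1,4,3,5)] cbr_cong[OF assms(1,2,5,3,4)] by simp

lemma tor_add_left:
  assumes "cvf X" "cvf X'" "cvf Y" "p \<in> U"
  shows "tor (X + X') Y p = tor X Y p + tor X' Y p"
  using assms
  by (simp add: torsion_def nab_add_left nab_add_right cbr_add_left algebra_simps)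

text \<open>The Leibniz rule for \<open>nab Y (cmul h X)\<close> and the bracket both produce (Y h)
  X, with opposite signs.\<close>

lemma tor_cmul_left:
  assumes "csmooth U h" "cvf X" "cvf Y" "p \<in> U"
  shows "tor (cmul h X) Y p = cscale (h p) (tor X Y p)"
  using assms
  by (simp add: torsion_def nab_cmul_left nab_cmul_right cbr_cmul_left) (simp add: fun_eq_iff cscale_def algebra_simps)

lemma tor_diff_left:
  "cvf X \<Longrightarrow> cvf X' \<Longrightarrow> cvf Y \<Longrightarrow> p \<in> U \<Longrightarrow> tor (X - X') Y p = tor X Y p - tor X' Y p"
  unfolding cdiff_eq_cmul by (simp add: tor_add_left tor_cmul_left csmooth_const cvf_cmul)

lemma curv_cong:
  assumes "cvf X" "cvf Y" "cvf Z" "\<And>q. q \<in> U \<Longrightarrow> X q = X' q" "p \<in> U"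
  shows "curv X Y Z p = curv X' Y Z p"
proof -
  have "nab X (nab Y Z) p = nab X' (nab Y Z) p"
    using assms by (intro nab_cong cvf_nab) auto
  moreover have "nab Y (nab X Z) p = nab Y (nab X' Z) p"
    using assms by (intro nab_cong cvf_nab) auto
  moreover have "nab (cbr X Y) Z p = nab (cbr X' Y) Z p"
    using assms by (intro nab_cong cvf_cbr cbr_cong) auto
  ultimately show ?thesis by (simp add: curvature_def)
qed

lemma curv_add_left:
  assumes "cvf X" "cvf X'" "cvf Y" "cvf Z" "p \<in> U"
  shows "curv (X + X') Y Z p = curv X Y Z p + curv X' Y Z p"
proof -
  \<comment> \<open>Additivity in the direction holds at points of U and is carried under the outer
    derivative by \<open>nab_cong\<close>.\<close>
  have "nab Y (nab (X + X') Z) p = nab Y (nab X Z + nab X' Z) p"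
    using assms by (intro nab_cong cvf_nab cvf_add) (auto simp: nab_add_left)
  moreover have "nab (cbr (X + X') Y) Z p = nab (cbr X Y + cbr X' Y) Z p"
    using assms by (intro nab_cong cvf_cbr cvf_add) (auto simp: cbr_add_left)
  ultimately show ?thesis
    using assms by (simp add: curvature_def nab_add_left nab_add_right cvf_nab cvf_cbr)
qed

text \<open>The second derivative along Y and the bracket each contribute (Y h) times
  \<open>nab X Z\<close>, with opposite signs.\<close>

lemma curv_cmul_left:
  assumes "csmooth U h" "cvf X" "cvf Y" "cvf Z" "p \<in> U"
  shows "curv (cmul h X) Y Z p = cscale (h p) (curv X Y Z p)"
proof -
  \<comment> \<open>The derivative of h is itself the coefficient of a field in the bracket term, so
    it has to be smooth.\<close>
  have Yh: "csmooth U (cderiv Y h)" using assms open_U by (intro csmooth_cderiv) auto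
  have "nab Y (nab (cmul h X) Z) p = nab Y (cmul h (nab X Z)) p"
    using assms by (intro nab_cong cvf_nab cvf_cmul) (auto simp: nab_cmul_left, simp add: cmul_def)
  moreover have "nab (cbr (cmul h X) Y) Z p = nab (cmul h (cbr X Y) - cmul (cderiv Y h) X) Z p"
    using assms by (intro nab_cong cvf_cbr cvf_cmul) (auto simp: cbr_cmul_left, simp add: cmul_def)
  ultimately show ?thesis
    using assms Yh
    by (simp add: curvature_def nab_diff_left nab_cmul_left nab_cmul_right cvf_nab cvf_cbr cvf_cmul)
      (simp add: fun_eq_iff cscale_def algebra_simps)
qed

lemma curv_diff_left:
  "cvf X \<Longrightarrow> cvf X' \<Longrightarrow> cvf Y \<Longrightarrow> cvf Z \<Longrightarrow> p \<in> U \<Longrightarrow>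
    curv (X - X') Y Z p = curv X Y Z p - curv X' Y Z p"
  unfolding cdiff_eq_cmul by (simp add: curv_add_left curv_cmul_left csmooth_const cvf_cmul)

section \<open>The Bianchi identities of a connection with torsion\<close>

lemma cvf_nabla_torsion: "cvf V \<Longrightarrow> cvf X \<Longrightarrow> cvf Y \<Longrightarrow> cvf (nabla_torsion \<A> D V X Y)"
  unfolding nabla_torsion_def by (intro cvf_diff cvf_nab cvf_tor)

text \<open>After the expansions \<open>n\<close> and \<open>t\<close>, the torsions of covariant
  derivatives and the terms \<open>nab C (cbr A B)\<close> cancel in the cyclic sum. The second
  derivatives and \<open>nab (cbr A B) C\<close> form the curvature, and the double brackets add up
  to zero by Jacobi.\<close>

lemma first_bianchi:
  assumes X: "cvf X" and Y: "cvf Y" and Z: "cvf Z" and p: "p \<in> U"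
  shows "curv X Y Z p + curv Y Z X p + curv Z X Y p =
    nabla_torsion \<A> D X Y Z p + nabla_torsion \<A> D Y Z X p + nabla_torsion \<A> D Z X Y p
    + tor (tor X Y) Z p + tor (tor Y Z) X p + tor (tor Z X) Y p"
proof -
  have n: "nabla_torsion \<A> D A B C p =
      nab A (nab B C) p - nab A (nab C B) p - nab A (cbr B C) p
      - tor (nab A B) C p + tor (nab A C) B p"
    if "cvf A" "cvf B" "cvf C" for A B C
  proof -
    have "nab A (tor B C) p = nab A (nab B C) p - nab A (nab C B) p - nab A (cbr B C) p"
      unfolding torsion_def using that p by (simp add: nab_diff_right cvf_nab cvf_cbr cvf_diff)
    \<comment> \<open>Antisymmetry puts the covariant derivative into the first slot in both torsion
      terms, so that they match those of \<open>t\<close>.\<close>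
    then show ?thesis
      using tor_antisym[of B "nab A C"] by (simp add: nabla_torsion_def)
  qed
  have t: "tor (tor A B) C p = tor (nab A B) C p - tor (nab B A) C p
      - nab (cbr A B) C p + nab C (cbr A B) p + cbr (cbr A B) C p"
    if "cvf A" "cvf B" "cvf C" for A B C
  proof -
    have "tor (tor A B) C p = tor (nab A B) C p - tor (nab B A) C p - tor (cbr A B) C p"
      \<comment> \<open>Only the inner torsion is unfolded, so that the outer one can be split by
        linearity.\<close>
      unfolding torsion_def[of _ _ A B] using that p by (simp add: tor_diff_left cvf_nab cvf_cbr cvf_diff)
    then show ?thesis by (simp add: torsion_def[of _ _ "cbr A B"])
  qed
  have "cbr (cbr X Y) Z p + cbr (cbr Y Z) X p = - cbr (cbr Z X) Y p"
    using cbr_jacobi[OF X Y Z p] by (simp add: eq_neg_iff_add_eq_0)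
  then show ?thesis
    by (simp add: n t X Y Z curvature_def algebra_simps)
qed

text \<open>The covariant derivative of the curvature as an operator on fields. In this form the
  second Bianchi identity concerns the connection alone; \<open>nabla_curvature4_eq\<close> brings
  in the metric.\<close>

definition nabla_curv where
  "nabla_curv V X Y Z = nab V (curv X Y Z) - curv (nab V X) Y Z - curv X (nab V Y) Z - curv X Y (nab V Z)"

lemma cvf_nabla_curv: "cvf V \<Longrightarrow> cvf X \<Longrightarrow> cvf Y \<Longrightarrow> cvf Z \<Longrightarrow> cvf (nabla_curv V X Y Z)"
  unfolding nabla_curv_def by (intro cvf_diff cvf_nab cvf_curv)

text \<open>Two Jacobi identities are at work: one for the commutators of the operators
  \<open>nab X\<close>, \<open>nab Y\<close>, \<open>nab Z\<close>, whose threefold products cancel,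
  and one for the brackets of the fields. The curvatures of covariant derivatives cancel as in
  \<open>first_bianchi\<close>.\<close>

lemma second_bianchi:
  assumes X: "cvf X" and Y: "cvf Y" and Z: "cvf Z" and W: "cvf W" and p: "p \<in> U"
  shows "nabla_curv X Y Z W p + nabla_curv Y Z X W p + nabla_curv Z X Y W p
    + curv (tor X Y) Z W p + curv (tor Y Z) X W p + curv (tor Z X) Y W p = 0"
proof -
  have n: "nabla_curv A B C W p =
      nab A (nab B (nab C W)) p - nab A (nab C (nab B W)) p - nab A (nab (cbr B C) W) p
      - curv (nab A B) C W p + curv (nab A C) B W p - curv B C (nab A W) p"
    if "cvf A" "cvf B" "cvf C" for A B C
  proof -
    have "nab A (curv B C W) p = nab A (nab B (nab C W)) p - nab A (nab C (nab B W)) p - nab A (nab (cbr B C) W) p"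
      unfolding curvature_def using that p W by (simp add: nab_diff_right cvf_nab cvf_cbr cvf_diff)
    then show ?thesis
      using curv_antisym[OF that(2) cvf_nab[OF that(1,3)] W p] by (simp add: nabla_curv_def)
  qed
  have t: "curv (tor A B) C W p = curv (nab A B) C W p - curv (nab B A) C W p - curv (cbr A B) C W p"
    if "cvf A" "cvf B" "cvf C" for A B C
    unfolding torsion_def[of _ _ A B] using that p W by (simp add: curv_diff_left cvf_nab cvf_cbr cvf_diff)
  have "nab (cbr (cbr X Y) Z) W p + nab (cbr (cbr Y Z) X) W p + nab (cbr (cbr Z X) Y) W p =
      nab (cbr (cbr X Y) Z + cbr (cbr Y Z) X + cbr (cbr Z X) Y) W p"
    using X Y Z W p by (simp add: nab_add_left cvf_cbr cvf_add)
  \<comment> \<open>The Jacobi sum is known to vanish only on U; by \<open>nab_cong\<close> that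
    suffices to replace it by the zero field.\<close>
  also have "\<dots> = nab 0 W p"
    using X Y Z W p by (intro nab_cong cvf_add cvf_cbr) (auto simp: cbr_jacobi)
  finally have j: "nab (cbr (cbr X Y) Z) W p + nab (cbr (cbr Y Z) X) W p = - nab (cbr (cbr Z X) Y) W p"
    using W p by (simp add: nab_0_left eq_neg_iff_add_eq_0)
  show ?thesis
    \<comment> \<open>Only curvatures with a bracket in the first slot or a covariant derivative in
      the last are unfolded; those with \<open>nab\<close> in the first slot stay intact and
      cancel.\<close>
    using j by (simp add: n t X Y Z curvature_def[of _ _ "cbr _ _"] curvature_def[of _ _ _ _ "nab _ _"] algebra_simps)
qed

end

section \<open>Almost Hermitian structures\<close>

lemma re_vec_simps:
  "re_vec (v + w) = re_vec v + re_vec w" "im_vec (v + w) = im_vec v + im_vec w"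
  "re_vec (cscale c v) = (\<lambda>f. Re c * re_vec v f) + (\<lambda>f. - Im c * im_vec v f)"
  "im_vec (cscale c v) = (\<lambda>f. Re c * im_vec v f) + (\<lambda>f. Im c * re_vec v f)"
  "re_vec (\<lambda>f. cnj (v f)) = re_vec v" "im_vec (\<lambda>f. cnj (v f)) = (\<lambda>f. - 1 * im_vec v f)"
  "re_vec (cpx_vec x y) = x" "im_vec (cpx_vec x y) = y"
  by (simp_all add: fun_eq_iff re_vec_def im_vec_def cscale_def cpx_vec_def)

lemma cvec_eq_iff: "v = w \<longleftrightarrow> re_vec v = re_vec w \<and> im_vec v = im_vec w"
  by (auto simp: fun_eq_iff re_vec_def im_vec_def complex_eq_iff)

lemma re_field_apply: "re_field X p = re_vec (X p)" "im_field X p = im_vec (X p)"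
  by (simp_all add: re_field_def im_field_def)

locale hermitian_domain = connection_domain \<A> U D
  for \<A> :: "('a::{t2_space, second_countable_topology}, 'e::euclidean_space) atlas" and U D +
  fixes J :: "'a \<Rightarrow> 'a rvec \<Rightarrow> 'a rvec" and g :: "'a \<Rightarrow> 'a rvec \<Rightarrow> 'a rvec \<Rightarrow> real"
  assumes hermitian: "almost_hermitian \<A> J g" and canonical: "canonical_connection \<A> J g D"
begin

abbreviation form :: "'a \<Rightarrow> 'a cvec \<Rightarrow> 'a cvec \<Rightarrow> complex" where "form \<equiv> cext_form g"
abbreviation Jc :: "'a \<Rightarrow> 'a cvec \<Rightarrow> 'a cvec" where "Jc \<equiv> cext_endo J"

lemma g_rules:
  assumes "tangent \<A> p v" "tangent \<A> p w"
  shows g_sym: "g p v w = g p w v"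
    and g_add_left: "tangent \<A> p u \<Longrightarrow> g p (u + v) w = g p u w + g p v w"
    and g_scale_left: "g p (\<lambda>f. c * v f) w = c * g p v w"
    and g_J: "g p (J p v) (J p w) = g p v w"
  using hermitian assms unfolding almost_hermitian_def riemannian_metric_def by simp_all

lemma g_smooth: "vf X \<Longrightarrow> vf Y \<Longrightarrow> smooth_fun \<A> U (\<lambda>p. g p (X p) (Y p))"
  using hermitian open_U unfolding almost_hermitian_def riemannian_metric_def by simp

lemma J_rules:
  assumes "tangent \<A> p v"
  shows tangent_J: "tangent \<A> p (J p v)"
    and J_J: "J p (J p v) = - v"
    and J_add: "tangent \<A> p w \<Longrightarrow> J p (v + w) = J p v + J p w"
    and J_scale: "J p (\<lambda>f. c * v f) = (\<lambda>f. c * J p v f)"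
  using hermitian assms unfolding almost_hermitian_def almost_complex_structure_def by simp_all

lemma g_add_right:
  "tangent \<A> p u \<Longrightarrow> tangent \<A> p v \<Longrightarrow> tangent \<A> p w \<Longrightarrow> g p w (u + v) = g p w u + g p w v"
  by (simp add: g_sym[of p w] tangent_add g_add_left)

lemma g_diff_left:
  "tangent \<A> p u \<Longrightarrow> tangent \<A> p v \<Longrightarrow> tangent \<A> p w \<Longrightarrow> g p (u - v) w = g p u w - g p v w"
  using g_add_left[of p "\<lambda>f. -1 * v f" w u] g_scale_left[of p v w "-1"] tangent_scale[of p v "-1"]
  by (simp add: plus_fun_def fun_diff_def)

lemma g_diff_right:
  "tangent \<A> p u \<Longrightarrow> tangent \<A> p v \<Longrightarrow> tangent \<A> p w \<Longrightarrow> g p w (u - v) = g p w u - g p w v"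
  by (simp add: g_sym[of p w] tangent_diff g_diff_left)

lemma ctangent_parts: "ctangent \<A> p v \<Longrightarrow> tangent \<A> p (re_vec v)" "ctangent \<A> p v \<Longrightarrow> tangent \<A> p (im_vec v)"
  by (simp_all add: ctangent_def)

lemma vf_tangent: "vf X \<Longrightarrow> p \<in> U \<Longrightarrow> tangent \<A> p (X p)"
  by (simp add: vector_field_def)

section \<open>The complex bilinear extension of the metric\<close>

lemma form_sym: "ctangent \<A> p v \<Longrightarrow> ctangent \<A> p w \<Longrightarrow> form p v w = form p w v"
  using ctangent_parts[of p v] ctangent_parts[of p w] unfolding cext_form_def
  by (simp add: complex_eq_iff g_sym[of p "re_vec v"] g_sym[of p "im_vec v"])

lemma form_add_left:
  "ctangent \<A> p v \<Longrightarrow> ctangent \<A> p v' \<Longrightarrow> ctangent \<A> p w \<Longrightarrow> form p (v + v') w = form p v w + form p v' w"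
  using ctangent_parts[of p v] ctangent_parts[of p v'] ctangent_parts[of p w] unfolding cext_form_def
  by (simp add: complex_eq_iff re_vec_simps g_add_left)

text \<open>This has the shape in which \<open>re_vec_simps\<close> leaves the parts of
  \<open>cscale c v\<close>.\<close>

lemma g_lin_left:
  "tangent \<A> p u \<Longrightarrow> tangent \<A> p v \<Longrightarrow> tangent \<A> p w \<Longrightarrow>
    g p ((\<lambda>f. a * u f) + (\<lambda>f. b * v f)) w = a * g p u w + b * g p v w"
  by (simp add: g_add_left tangent_scale g_scale_left)

lemma form_cscale_left:
  assumes "ctangent \<A> p v" "ctangent \<A> p w"
  shows "form p (cscale c v) w = c * form p v w"
  unfolding cext_form_def re_vec_simps
    g_lin_left[OF ctangent_parts(1,2)[OF assms(1)] ctangent_parts(1)[OF assms(2)]]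
    g_lin_left[OF ctangent_parts(1,2)[OF assms(1)] ctangent_parts(2)[OF assms(2)]]
    g_lin_left[OF ctangent_parts(2,1)[OF assms(1)] ctangent_parts(1)[OF assms(2)]]
    g_lin_left[OF ctangent_parts(2,1)[OF assms(1)] ctangent_parts(2)[OF assms(2)]]
  by (simp add: complex_eq_iff algebra_simps)

lemma form_uminus_left: "ctangent \<A> p v \<Longrightarrow> ctangent \<A> p w \<Longrightarrow> form p (- v) w = - form p v w"
  using form_cscale_left[of p v w "-1"] by simp

lemma form_diff_left:
  "ctangent \<A> p v \<Longrightarrow> ctangent \<A> p v' \<Longrightarrow> ctangent \<A> p w \<Longrightarrow> form p (v - v') w = form p v w - form p v' w"
  using form_add_left[of p v "cscale (-1) v'" w] ctangent_cscale[of p v' "-1"]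
  by (simp add: form_uminus_left)

lemma form_0_left: "ctangent \<A> p w \<Longrightarrow> form p 0 w = 0"
  using form_cscale_left[of p 0 w 0] by (simp add: ctangent_0)

lemma form_sum_left:
  "finite S \<Longrightarrow> (\<And>s. s \<in> S \<Longrightarrow> ctangent \<A> p (v s)) \<Longrightarrow> ctangent \<A> p w \<Longrightarrow>
    form p (\<Sum>s\<in>S. cscale (c s) (v s)) w = (\<Sum>s\<in>S. c s * form p (v s) w)"
  by (induction S rule: finite_induct)
    (simp_all add: form_0_left form_add_left form_cscale_left ctangent_cscale ctangent_sum)

lemma csmooth_form:
  assumes "cvf X" "cvf Y" shows "csmooth U (\<lambda>p. form p (X p) (Y p))"
  using g_smooth[OF cvf_vf(1)[OF assms(1)] cvf_vf(1)[OF assms(2)]]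
    g_smooth[OF cvf_vf(1)[OF assms(1)] cvf_vf(2)[OF assms(2)]]
    g_smooth[OF cvf_vf(2)[OF assms(1)] cvf_vf(1)[OF assms(2)]]
    g_smooth[OF cvf_vf(2)[OF assms(1)] cvf_vf(2)[OF assms(2)]] open_U
  by (simp add: csmooth_def cext_form_def re_field_apply smooth_fun_add smooth_fun_diff)

text \<open>The real metric condition is applied to the real and imaginary parts of V, X and Y,
  eight instances in all, and the results are reassembled.\<close>

lemma cderiv_form:
  assumes V: "cvf V" and X: "cvf X" and Y: "cvf Y" and p: "p \<in> U"
  shows "cderiv V (\<lambda>q. form q (X q) (Y q)) p = form p (nab V X p) (Y p) + form p (X p) (nab V Y p)"
proof -
  have metric: "A p (\<lambda>q. g q (B q) (C q)) = g p (D A B p) (C p) + g p (B p) (D A C p)"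
    if "vf A" "vf B" "vf C" for A B C
  proof -
    have "metric_connection \<A> g D" using canonical by (simp add: canonical_connection_def)
    then show ?thesis unfolding metric_connection_def using that open_U p by simp
  qed
  have V': "V p h = Complex (re_field V p h) (im_field V p h)" for h
    by (simp add: re_field_def im_field_def re_vec_def im_vec_def)
  have near: "smooth_near \<A> p (\<lambda>q. g q (B q) (C q))" if "vf B" "vf C" for B C
    using g_smooth[OF that] open_U p unfolding smooth_near_def by blast
  note f = cvf_vf[OF V] cvf_vf[OF X] cvf_vf[OF Y]
  have "cderiv V (\<lambda>q. form q (X q) (Y q)) p =
      (V p (\<lambda>q. g q (re_field X q) (re_field Y q)) - V p (\<lambda>q. g q (im_field X q) (im_field Y q)))
      + \<i> * (V p (\<lambda>q. g q (re_field X q) (im_field Y q)) + V p (\<lambda>q. g q (im_field X q) (re_field Y q)))"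
    unfolding cderiv_def cext_form_def
    using ctangent_diff_arg[OF cvf_ctangent[OF V p] near near, OF f(3,5) f(4,6)]
      ctangent_plus_arg[OF cvf_ctangent[OF V p] near near, OF f(3,6) f(4,5)]
    by (simp add: re_field_apply)
  also have "\<dots> = form p (nab V X p) (Y p) + form p (X p) (nab V Y p)"
  proof -
    have nab_parts: "re_vec (nab V Z p) = D (re_field V) (re_field Z) p - D (im_field V) (im_field Z) p"
      "im_vec (nab V Z p) = D (re_field V) (im_field Z) p + D (im_field V) (re_field Z) p" for Z
      by (simp_all flip: re_field_apply add: re_field_cext_op im_field_cext_op)
    have t: "tangent \<A> p (A p)" if "vf A" for A using vf_tangent[OF that p] .
    show ?thesis
      unfolding V' cext_form_def nab_parts
      by (simp flip: re_field_apply add: metric f t vf_D g_diff_left g_add_left g_diff_right g_add_right complex_eq_iff)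
  qed
  finally show ?thesis .
qed

section \<open>The complex structure and the types of fields\<close>

lemma ctangent_Jc: "ctangent \<A> p v \<Longrightarrow> ctangent \<A> p (Jc p v)"
  by (simp add: ctangent_def cext_endo_def re_vec_simps tangent_J)

lemma Jc_Jc: "ctangent \<A> p v \<Longrightarrow> Jc p (Jc p v) = - v"
  by (simp add: cvec_eq_iff cext_endo_def re_vec_simps ctangent_def J_J)
    (simp add: fun_eq_iff re_vec_def im_vec_def)

lemma Jc_add: "ctangent \<A> p v \<Longrightarrow> ctangent \<A> p w \<Longrightarrow> Jc p (v + w) = Jc p v + Jc p w"
  by (simp add: cvec_eq_iff cext_endo_def re_vec_simps ctangent_def J_add)

lemma J_uminus: "tangent \<A> p v \<Longrightarrow> J p (\<lambda>f. - v f) = (\<lambda>f. - J p v f)"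
  using J_scale[of p v "-1"] by simp

lemma J_uminus_scale: "tangent \<A> p v \<Longrightarrow> J p (\<lambda>f. - (c * v f)) = (\<lambda>f. - (c * J p v f))"
  using J_scale[of p v "-c"] by simp

lemma tangent_uminus_scale: "tangent \<A> p v \<Longrightarrow> tangent \<A> p (\<lambda>f. - (c * v f))"
  using tangent_scale[of p v "-c"] by simp

lemma Jc_cscale: "ctangent \<A> p v \<Longrightarrow> Jc p (cscale c v) = cscale c (Jc p v)"
  by (simp add: cvec_eq_iff cext_endo_def re_vec_simps ctangent_def J_add J_scale tangent_scale
      tangent_uminus_scale J_uminus_scale)

lemma Jc_cnj: "ctangent \<A> p v \<Longrightarrow> Jc p (\<lambda>f. cnj (v f)) = (\<lambda>f. cnj (Jc p v f))"
  by (simp add: cvec_eq_iff cext_endo_def re_vec_simps ctangent_def J_uminus)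

lemma Jc_diff: "ctangent \<A> p v \<Longrightarrow> ctangent \<A> p w \<Longrightarrow> Jc p (v - w) = Jc p v - Jc p w"
  using Jc_add[of p v "cscale (-1) w"] Jc_cscale[of p w "-1"] ctangent_cscale[of p w "-1"] by simp

lemma form_Jc: "ctangent \<A> p v \<Longrightarrow> ctangent \<A> p w \<Longrightarrow> form p (Jc p v) (Jc p w) = form p v w"
  by (simp add: cext_form_def cext_endo_def re_vec_simps ctangent_def g_J)

text \<open>The eigenvalue is \<i> for type (1,0) and - \<i> for type (0,1); keeping it as a
  parameter treats both types at once.\<close>

definition eigen :: "complex \<Rightarrow> 'a cfield \<Rightarrow> bool" where
  "eigen c X \<longleftrightarrow> (\<forall>q\<in>U. Jc q (X q) = cscale c (X q))"

text \<open>J is an isometry, so the pairing equals c * c = - 1 times itself.\<close>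

lemma form_eigen:
  assumes "cvf X" "cvf Y" "eigen c X" "eigen c Y" "c * c = - 1" "p \<in> U"
  shows "form p (X p) (Y p) = 0"
proof -
  have t: "ctangent \<A> p (X p)" "ctangent \<A> p (Y p)" using assms cvf_ctangent by auto
  have "form p (X p) (Y p) = form p (cscale c (X p)) (cscale c (Y p))"
    using form_Jc[OF t] assms by (simp add: eigen_def)
  also have "\<dots> = c * form p (cscale c (Y p)) (X p)"
    using t by (simp add: form_cscale_left ctangent_cscale form_sym[of p "X p"])
  also have "\<dots> = (c * c) * form p (X p) (Y p)"
    using t by (simp add: form_cscale_left form_sym[of p "X p"])
  finally show ?thesis by (simp add: assms(5))
qed

lemma eigen_diff: "cvf X \<Longrightarrow> cvf Y \<Longrightarrow> eigen c X \<Longrightarrow> eigen c Y \<Longrightarrow> eigen c (X - Y)"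
  by (simp add: eigen_def Jc_diff cvf_ctangent) (simp add: fun_eq_iff cscale_def algebra_simps)

text \<open>The connection commutes with J, and c is constant, so the Leibniz rule lets c pass
  through the derivative.\<close>

lemma eigen_nab:
  assumes "cvf V" "cvf X" "eigen c X" shows "eigen c (nab V X)"
  unfolding eigen_def
proof
  fix p assume p: "p \<in> U"
  \<comment> \<open>\<open>JX\<close> and the multiple of X by c agree only on U. The first form
    lets J commute with \<open>D\<close>, the second lets the constant out.\<close>
  define JX where "JX = (\<lambda>q. Jc q (X q))"
  have cX: "cvf (cmul (\<lambda>_. c) X)" using assms by (intro cvf_cmul csmooth_const)
  have eq: "cmul (\<lambda>_. c) X q = JX q" if "q \<in> U" for q
    using assms(3) that by (simp add: JX_def eigen_def cmul_def)
  have JX: "cvf JX" using cvf_cong[OF cX eq] .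
  have DJ: "D A (\<lambda>q. J q (B q)) p = J p (D A B p)" if "vf A" "vf B" for A B
  proof -
    have "complex_connection \<A> J D" using canonical by (simp add: canonical_connection_def)
    then show ?thesis unfolding complex_connection_def using that open_U p by simp
  qed
  have r: "re_field JX = (\<lambda>q. J q (re_field X q))" "im_field JX = (\<lambda>q. J q (im_field X q))"
    by (simp_all add: fun_eq_iff JX_def cext_endo_def re_field_apply re_vec_simps)
  have t: "tangent \<A> p (A p)" if "vf A" for A using vf_tangent[OF that p] .
  have J_diff: "J p (v - w) = J p v - J p w" if "tangent \<A> p v" "tangent \<A> p w" for v w
    using J_add[OF that(1) tangent_uminus[OF that(2)]] J_uminus[OF that(2)]
    by (simp add: plus_fun_def fun_diff_def)
  note f = cvf_vf[OF assms(1)] cvf_vf[OF assms(2)]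
  have "Jc p (nab V X p) = nab V JX p"
    by (simp add: cvec_eq_iff cext_endo_def re_vec_simps flip: re_field_apply)
      (simp add: re_field_cext_op im_field_cext_op r DJ f t vf_D J_add J_diff)
  also have "\<dots> = nab V (cmul (\<lambda>_. c) X) p"
    using nab_cong[OF assms(1) cX _ eq p] by simp
  also have "\<dots> = cscale c (nab V X p)"
    using assms p
    by (simp add: nab_cmul_right csmooth_const cderiv_const[where p = p and Z = V] cvf_ctangent)
  finally show "Jc p (nab V X p) = cscale c (nab V X p)" .
qed

lemma eigen_curv: "cvf X \<Longrightarrow> cvf Y \<Longrightarrow> cvf Z \<Longrightarrow> eigen c Z \<Longrightarrow> eigen c (curv X Y Z)"
  unfolding curvature_def by (intro eigen_diff eigen_nab cvf_diff cvf_nab cvf_cbr)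

lemma eigen_cnj:
  assumes "cvf X" "eigen c X" shows "eigen (cnj c) (cnj_field X)"
  using assms unfolding eigen_def cnj_field_def
  by (auto simp: Jc_cnj cvf_ctangent cscale_def)

lemma tor_mixed:
  assumes "cvf X" "cvf Y" "eigen \<i> X" "eigen (- \<i>) Y" "p \<in> U"
  shows "tor X Y p = 0"
proof -
  \<comment> \<open>The canonical connection is characterised by pairs of a (1,0)-field and a
    conjugated (1,0)-field, so Y is written as the conjugate of its conjugate.\<close>
  have Y: "Y = cnj_field (cnj_field Y)" by (simp add: cnj_field_def)
  have "type10 \<A> J q (X q) \<and> type10 \<A> J q (cnj_field Y q)" if "q \<in> U" for q
    using assms cvf_cnj[OF assms(2)] eigen_cnj[OF assms(2,4)] that
    by (auto simp: type10_def eigen_def cvf_ctangent)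
  moreover have "open U \<and> cvf X \<and> cvf (cnj_field Y) \<and>
      (\<forall>q\<in>U. type10 \<A> J q (X q) \<and> type10 \<A> J q (cnj_field Y q)) \<longrightarrow>
      (\<forall>q\<in>U. tor X (cnj_field (cnj_field Y)) q = 0)"
    using canonical unfolding canonical_connection_def by (elim conjE) (erule allE)+
  ultimately have "tor X (cnj_field (cnj_field Y)) p = 0"
    using open_U assms(1,5) cvf_cnj[OF assms(2)] by simp
  then show ?thesis using Y by simp
qed

text \<open>\<open>tor X Y\<close> vanishes on all of U and so does its derivative; in the other two
  terms the arguments are still of mixed type by \<open>eigen_nab\<close>.\<close>

lemma nabla_torsion_mixed:
  assumes "cvf V" "cvf X" "cvf Y" "eigen \<i> X" "eigen (- \<i>) Y" "p \<in> U"
  shows "nabla_torsion \<A> D V X Y p = 0"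
proof -
  have "nab V (tor X Y) p = nab V 0 p"
    using assms by (intro nab_cong cvf_tor) (auto simp: tor_mixed)
  then show ?thesis
    using assms by (simp add: nabla_torsion_def nab_0_right tor_mixed cvf_nab eigen_nab)
qed

lemma nabla_torsion_antisym:
  assumes "cvf V" "cvf X" "cvf Y" "p \<in> U"
  shows "nabla_torsion \<A> D V X Y p = - nabla_torsion \<A> D V Y X p"
  using nab_uminus_right[OF assms(1) cvf_tor[OF assms(3,2)] assms(4)]
  by (simp add: nabla_torsion_def tor_antisym[of X] tor_antisym[of "nab V X"])

lemma nabla_curv_antisym:
  assumes "cvf V" "cvf X" "cvf Y" "cvf Z" "p \<in> U"
  shows "nabla_curv V X Y Z p = - nabla_curv V Y X Z p"
proof -
  have "nab V (curv X Y Z) p = nab V (- curv Y X Z) p"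
    using assms by (intro nab_cong cvf_curv) (auto simp: curv_antisym[of X Y])
  also have "\<dots> = - nab V (curv Y X Z) p"
    using assms by (intro nab_uminus_right cvf_curv)
  finally show ?thesis
    using assms by (simp add: nabla_curv_def curv_antisym[of X Y] curv_antisym[of "nab V X"]
        curv_antisym[of X "nab V Y"] cvf_nab)
qed

text \<open>The commutator formula for the bracket is applied to the function
  \<open>form q (Z q) (W q)\<close>. In its second derivatives the products of first derivatives of
  Z and W are symmetric in the two directions and cancel; what remains is the sum of the two
  curvature terms.\<close>

lemma form_curv_skew:
  assumes X: "cvf X" and Y: "cvf Y" and Z: "cvf Z" and W: "cvf W" and p: "p \<in> U"
  shows "form p (curv X Y Z p) (W p) = - form p (curv X Y W p) (Z p)"
proof -
  define h where "h = (\<lambda>q. form q (Z q) (W q))"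
  note n = csmooth_imp_near[OF csmooth_form p]
  have dd: "cderiv A (cderiv B h) p = form p (nab A (nab B Z) p) (W p) + form p (nab B Z p) (nab A W p)
      + form p (nab A Z p) (nab B W p) + form p (Z p) (nab A (nab B W) p)" if "cvf A" "cvf B" for A B
  proof -
    have "cderiv A (cderiv B h) p = cderiv A (\<lambda>q. form q (nab B Z q) (W q) + form q (Z q) (nab B W q)) p"
      unfolding h_def using that Z W p
      by (intro cderiv_cong[where Z = A] cvf_ctangent eventually_U) (auto simp: cderiv_form)
    also have "\<dots> = cderiv A (\<lambda>q. form q (nab B Z q) (W q)) p + cderiv A (\<lambda>q. form q (Z q) (nab B W q)) p"
      using that Z W p by (intro cderiv_add[where Z = A] cvf_ctangent n cvf_nab)
    finally show ?thesis using that Z W p by (simp add: cderiv_form cvf_nab)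
  qed
  have br: "cderiv (cbr X Y) h p = form p (nab (cbr X Y) Z p) (W p) + form p (Z p) (nab (cbr X Y) W p)"
    unfolding h_def using X Y Z W p by (simp add: cderiv_form cvf_cbr)
  have "cderiv (cbr X Y) h p = cderiv X (cderiv Y h) p - cderiv Y (cderiv X h) p"
    unfolding h_def using X Y Z W p by (simp add: cderiv_cbr n)
  then have sum: "form p (nab X (nab Y Z) p) (W p) + form p (nab X (nab Y W) p) (Z p)
      - form p (nab Y (nab X Z) p) (W p) - form p (nab Y (nab X W) p) (Z p) =
      form p (nab (cbr X Y) Z p) (W p) + form p (nab (cbr X Y) W p) (Z p)"
    using X Y Z W p by (simp add: br dd form_sym[of p "Z p"] cvf_ctangent cvf_nab cvf_cbr)
  have curv: "form p (curv X Y A p) (B p) =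
      form p (nab X (nab Y A) p) (B p) - form p (nab Y (nab X A) p) (B p) - form p (nab (cbr X Y) A p) (B p)"
    if "cvf A" "cvf B" for A B
    using X Y that p
    by (simp add: curvature_def form_diff_left cvf_ctangent ctangent_diff cvf_nab cvf_cbr)
  show ?thesis
    unfolding curv[OF Z W] curv[OF W Z] using sum by (simp add: algebra_simps)
qed

text \<open>By \<open>cderiv_form\<close> the derivative of the pairing yields a term with
  \<open>nab V Y\<close>, which cancels the one subtracted in the definition.\<close>

lemma nabla_curvature4_eq:
  assumes "cvf V" "cvf X" "cvf Y" "cvf Z" "cvf W" "p \<in> U"
  shows "nabla_curvature4 \<A> g D V X Y Z W p = form p (nabla_curv V Z W X p) (Y p)"
proof -
  have "curvature4 \<A> g D X Y Z W = (\<lambda>q. form q (curv Z W X q) (Y q))"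
    by (simp add: fun_eq_iff curvature4_def)
  then show ?thesis
    using assms
    by (simp add: nabla_curvature4_def curvature4_def[where p = p] cderiv_form cvf_curv nabla_curv_def form_diff_left
      cvf_ctangent ctangent_diff cvf_nab)
qed

end

section \<open>Components in a unitary frame\<close>

lemma sum_UNIV_sum:
  fixes f :: "'n::finite + 'n \<Rightarrow> 'b::comm_monoid_add"
  shows "(\<Sum>s\<in>UNIV. f s) = (\<Sum>s\<in>UNIV. f (hol s)) + (\<Sum>s\<in>UNIV. f (bar s))"
  using sum.Plus[of "UNIV :: 'n set" "UNIV :: 'n set" f] by (simp add: UNIV_Plus_UNIV o_def)

text \<open>Conjugation of indices. For a unitary frame, \<open>full_frame e (dual a)\<close> is
  dual to \<open>full_frame e a\<close> under the bilinear form, so pairing with it extracts a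
  coefficient.\<close>

definition dual :: "'n + 'n \<Rightarrow> 'n + 'n" where
  "dual a = (case a of Inl i \<Rightarrow> Inr i | Inr i \<Rightarrow> Inl i)"

lemma dual_simps [simp]: "dual (hol i) = bar i" "dual (bar i) = hol i"
  by (simp_all add: dual_def)

section \<open>Expansion in a unitary frame\<close>

locale unitary_domain = hermitian_domain \<A> U D J g
  for \<A> :: "('a::{t2_space, second_countable_topology}, 'e::euclidean_space) atlas" and U D J g +
  fixes e :: "'n::finite \<Rightarrow> 'a cfield"
  assumes frame: "unitary_frame \<A> J g U e"
begin

abbreviation E :: "'n + 'n \<Rightarrow> 'a cfield" where "E \<equiv> full_frame e"

lemma E_simps: "E (hol i) = e i" "E (bar i) = cnj_field (e i)"
  by (simp_all add: full_frame_def)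

lemma cvf_e: "cvf (e i)"
  using frame by (simp add: unitary_frame_def)

lemma cvf_E: "cvf (E a)"
  by (cases a) (simp_all add: E_simps cvf_e cvf_cnj)

lemma eigen_hol: "eigen \<i> (E (hol i))"
  using frame by (simp add: unitary_frame_def type10_def eigen_def E_simps)

lemma eigen_bar: "eigen (- \<i>) (E (bar i))"
  using eigen_cnj[OF cvf_E eigen_hol, of i] by (simp add: E_simps)

text \<open>Vectors of equal type pair to 0 by \<open>form_eigen\<close>; for opposite types the
  value is the unitarity condition, up to symmetry of the form.\<close>

lemma form_E:
  assumes p: "p \<in> U"
  shows "form p (E a p) (E (dual b) p) = (if a = b then 1 else 0)"
proof -
  have *: "form p (E (hol i) p) (E (bar j) p) = (if i = j then 1 else 0)" for i j
    using frame p by (simp add: unitary_frame_def E_simps)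
  show ?thesis
  proof (cases a; cases b)
    fix i j assume "a = bar i" "b = bar j"
    then show ?thesis using * form_sym[OF cvf_ctangent[OF cvf_E p] cvf_ctangent[OF cvf_E p]] by simp
  qed (use p in \<open>simp_all add: * form_eigen[OF cvf_E cvf_E eigen_hol eigen_hol]
      form_eigen[OF cvf_E cvf_E eigen_bar eigen_bar]\<close>)
qed

lemma form_E_sum:
  assumes p: "p \<in> U"
  shows "form p (\<Sum>a\<in>UNIV. cscale (c a) (E a p)) (E (dual b) p) = c b"
  using p by (simp add: form_sum_left cvf_ctangent cvf_E form_E if_distrib[of "(*) _"] cong: if_cong)

lemma ctangent_spanned:
  assumes p: "p \<in> U" and v: "ctangent \<A> p v"
  shows "\<exists>c. v = (\<Sum>a\<in>UNIV. cscale (c a) (E a p))"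
proof -
  \<comment> \<open>The vectors w and w' are the projections of v to the \<i> and - \<i> eigenspaces
    of J.\<close>
  define w where "w = cscale (1/2) (v - cscale \<i> (Jc p v))"
  define w' where "w' = cscale (1/2) (v + cscale \<i> (Jc p v))"
  \<comment> \<open>The hypothesis on the frame expands only (1,0)-vectors, so the (0,1)-part is
    conjugated before its expansion and back afterwards.\<close>
  define u where "u = (\<lambda>f. cnj (w' f))"
  have t: "ctangent \<A> p w" "ctangent \<A> p w'"
    unfolding w_def w'_def using v by (auto intro!: ctangent_cscale ctangent_diff ctangent_add ctangent_Jc)
  have Jw: "Jc p w = cscale \<i> w" "Jc p w' = cscale (- \<i>) w'"
    unfolding w_def w'_def using v
    by (simp_all add: Jc_cscale Jc_add Jc_diff Jc_Jc ctangent_cscale ctangent_diff ctangent_add ctangent_Jc)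
      (simp_all add: fun_eq_iff cscale_def algebra_simps)
  have "type10 \<A> J p w" "type10 \<A> J p u"
    unfolding type10_def u_def using t Jw by (simp_all add: ctangent_cnj Jc_cnj cscale_def)
  moreover have "\<exists>c. v = (\<Sum>i\<in>UNIV. cscale (c i) (e i p))" if "type10 \<A> J p v" for v
    using frame p that unfolding unitary_frame_def by (blast dest: bspec)
  ultimately obtain c d where c: "w = (\<Sum>i\<in>UNIV. cscale (c i) (e i p))" and d: "u = (\<Sum>i\<in>UNIV. cscale (d i) (e i p))"
    by blast
  have sum_app: "(\<Sum>i\<in>A. F i) f = (\<Sum>i\<in>A. F i f)" for A :: "'n set" and F :: "'n \<Rightarrow> 'a cvec" and f
    by (induction A rule: infinite_finite_induct) simp_all
  have "w' = (\<Sum>i\<in>UNIV. cscale (cnj (d i)) (cnj_field (e i) p))"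
  proof
    fix f
    have "w' f = cnj (u f)" by (simp add: u_def)
    then show "w' f = (\<Sum>i\<in>UNIV. cscale (cnj (d i)) (cnj_field (e i) p)) f"
      by (simp add: d sum_app cscale_def cnj_field_def)
  qed
  moreover have "v = w + w'" by (simp add: fun_eq_iff w_def w'_def cscale_def field_simps)
  ultimately have "v = (\<Sum>a\<in>UNIV. cscale (case_sum c (\<lambda>i. cnj (d i)) a) (E a p))"
    using c by (simp add: sum_UNIV_sum E_simps)
  then show ?thesis by blast
qed

text \<open>Pairing with the dual frame determines the coefficients of any expansion, which gives
  both the uniqueness required by the definite description and its value.\<close>

lemma frame_coeff_eq:
  assumes p: "p \<in> U" and v: "ctangent \<A> p v"
  shows "frame_coeff e p v a = form p v (E (dual a) p)"
proof -
  obtain c where c: "v = (\<Sum>a\<in>UNIV. cscale (c a) (E a p))" using ctangent_spanned[OF assms] by blast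
  have "frame_coeff e p v = c"
    unfolding frame_coeff_def
  proof (rule the_equality[where P = "\<lambda>c. v = (\<Sum>a\<in>UNIV. cscale (c a) (E a p))", OF c])
    fix d assume "v = (\<Sum>a\<in>UNIV. cscale (d a) (E a p))"
    then have "d a = c a" for a using form_E_sum[OF p, of d a] form_E_sum[OF p, of c a] c by simp
    then show "d = c" ..
  qed
  then show ?thesis using form_E_sum[OF p, of c a] c by simp
qed

lemma ctangent_expand:
  assumes p: "p \<in> U" and v: "ctangent \<A> p v"
  shows "v = (\<Sum>a\<in>UNIV. cscale (form p v (E (dual a) p)) (E a p))"
proof -
  obtain c where c: "v = (\<Sum>a\<in>UNIV. cscale (c a) (E a p))" using ctangent_spanned[OF assms] by blast
  then have "form p v (E (dual a) p) = c a" for a using form_E_sum[OF p, of c a] by simp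
  then show ?thesis using c by simp
qed

lemma field_expand:
  assumes "cvf Z" "q \<in> U"
  shows "Z q = (\<Sum>a\<in>UNIV. cmul (\<lambda>q. form q (Z q) (E (dual a) q)) (E a)) q"
proof -
  have sum_app: "(\<Sum>i\<in>A. F i) q = (\<Sum>i\<in>A. F i q)" for A :: "('n + 'n) set" and F :: "'n + 'n \<Rightarrow> 'a cfield"
    by (induction A rule: infinite_finite_induct) simp_all
  show ?thesis
    unfolding sum_app cmul_def using ctangent_expand[OF assms(2) cvf_ctangent[OF assms]] .
qed

text \<open>An abstract F, the value at p of an operator, serves torsion and curvature alike. The
  assumption \<open>F_cong\<close> is there because the expansion of Z in the frame holds only on
  U.\<close>

lemma linear_expand:
  assumes F_add: "\<And>X X'. cvf X \<Longrightarrow> cvf X' \<Longrightarrow> F (X + X') = F X + F X'"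
    and F_cmul: "\<And>h X. csmooth U h \<Longrightarrow> cvf X \<Longrightarrow> F (cmul h X) = cscale (h p) (F X)"
    and F_cong: "\<And>X X'. cvf X \<Longrightarrow> (\<And>q. q \<in> U \<Longrightarrow> X q = X' q) \<Longrightarrow> F X = F X'"
    and Z: "cvf Z"
  shows "F Z = (\<Sum>a\<in>UNIV. cscale (form p (Z p) (E (dual a) p)) (F (E a)))"
proof -
  have s: "csmooth U (\<lambda>q. form q (Z q) (E (dual a) q))" for a
    using Z by (intro csmooth_form cvf_E)
  have F0: "F 0 = 0"
    using F_cmul[OF csmooth_const cvf_0, of 0] by (simp flip: czero_eq_cmul)
  have sum: "F (\<Sum>a\<in>A. cmul (h a) (E a)) = (\<Sum>a\<in>A. cscale (h a p) (F (E a)))"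
    if "finite A" "\<And>a. csmooth U (h a)" for A and h :: "'n + 'n \<Rightarrow> 'a \<Rightarrow> complex"
    using that by (induction A rule: finite_induct)
      (simp_all add: F0 F_add F_cmul cvf_sum cvf_cmul cvf_E)
  have "F Z = F (\<Sum>a\<in>UNIV. cmul (\<lambda>q. form q (Z q) (E (dual a) q)) (E a))"
    by (rule F_cong[OF Z field_expand[OF Z]])
  then show ?thesis using sum[OF _ s] by simp
qed

lemma tor_expand:
  assumes "cvf Z" "cvf Y" "p \<in> U"
  shows "tor Z Y p = (\<Sum>a\<in>UNIV. cscale (form p (Z p) (E (dual a) p)) (tor (E a) Y p))"
  by (rule linear_expand[where F = "\<lambda>X. tor X Y p"])
    (rule tor_add_left tor_cmul_left tor_cong assms; simp add: assms)+

lemma curv_expand: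
  assumes "cvf Z" "cvf Y" "cvf W" "p \<in> U"
  shows "curv Z Y W p = (\<Sum>a\<in>UNIV. cscale (form p (Z p) (E (dual a) p)) (curv (E a) Y W p))"
  by (rule linear_expand[where F = "\<lambda>X. curv X Y W p"])
    (rule curv_add_left curv_cmul_left curv_cong assms; simp add: assms)+

end

section \<open>Components at a point\<close>

locale unitary_point = unitary_domain \<A> U D J g e
  for \<A> :: "('a::{t2_space, second_countable_topology}, 'e::euclidean_space) atlas" and U D J g
    and e :: "'n::finite \<Rightarrow> 'a cfield" +
  fixes p :: 'a
  assumes p: "p \<in> U"
begin

abbreviation T :: "'n + 'n \<Rightarrow> 'n + 'n \<Rightarrow> 'n + 'n \<Rightarrow> complex" where
  "T \<equiv> torsion_comp \<A> D e p"
abbreviation T' :: "'n + 'n \<Rightarrow> 'n + 'n \<Rightarrow> 'n + 'n \<Rightarrow> 'n + 'n \<Rightarrow> complex" where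
  "T' \<equiv> nabla_torsion_comp \<A> D e p"
abbreviation R :: "'n + 'n \<Rightarrow> 'n + 'n \<Rightarrow> 'n + 'n \<Rightarrow> 'n + 'n \<Rightarrow> complex" where
  "R \<equiv> curvature_comp \<A> g D e p"
abbreviation R' :: "'n + 'n \<Rightarrow> 'n + 'n \<Rightarrow> 'n + 'n \<Rightarrow> 'n + 'n \<Rightarrow> 'n + 'n \<Rightarrow> complex" where
  "R' \<equiv> nabla_curvature_comp \<A> g D e p"

lemmas cvf_intros = cvf_E cvf_tor cvf_curv cvf_nab cvf_nabla_torsion cvf_nabla_curv
lemmas ctangent_intros = cvf_ctangent[OF _ p] ctangent_add ctangent_diff

lemma T_eq: "T a b c = form p (tor (E a) (E b) p) (E (dual c) p)"
  by (simp add: torsion_comp_def frame_coeff_eq p ctangent_intros cvf_intros)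

lemma T'_eq: "T' a b c d = form p (nabla_torsion \<A> D (E c) (E a) (E b) p) (E (dual d) p)"
  by (simp add: nabla_torsion_comp_def frame_coeff_eq p ctangent_intros cvf_intros)

text \<open>The last two indices are the directions, the first is the vector acted on; pairing with
  \<open>E b\<close> takes the coefficient along \<open>E (dual b)\<close>.\<close>

lemma R_eq: "R a b c d = form p (curv (E c) (E d) (E a) p) (E b p)"
  by (simp add: curvature_comp_def curvature4_def)

lemma R'_eq: "R' a b c d m = form p (nabla_curv (E m) (E c) (E d) (E a) p) (E b p)"
  by (simp add: nabla_curvature_comp_def nabla_curvature4_eq cvf_E p)

lemma T_antisym: "T a b c = - T b a c"
  unfolding T_eq by (subst tor_antisym) (simp add: form_uminus_left ctangent_intros cvf_intros)

lemma T'_antisym: "T' a b c d = - T' b a c d"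
  unfolding T'_eq
  by (subst nabla_torsion_antisym) (simp_all add: form_uminus_left ctangent_intros cvf_intros p)

lemma R_antisym: "R a b c d = - R a b d c"
  unfolding R_eq by (subst curv_antisym) (simp_all add: form_uminus_left ctangent_intros cvf_intros p)

lemma R'_antisym: "R' a b c d m = - R' a b d c m"
  unfolding R'_eq by (subst nabla_curv_antisym) (simp_all add: form_uminus_left ctangent_intros cvf_intros p)

lemma R_skew: "R a b c d = - R b a c d"
  unfolding R_eq by (rule form_curv_skew) (simp_all add: cvf_E p)

lemma T_mixed: "T (hol i) (bar j) c = 0" "T (bar j) (hol i) c = 0"
proof -
  show "T (hol i) (bar j) c = 0"
    by (simp add: T_eq tor_mixed eigen_hol eigen_bar p cvf_E form_0_left ctangent_intros)
  then show "T (bar j) (hol i) c = 0" by (subst T_antisym) simp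
qed

lemma T'_mixed: "T' (hol i) (bar j) c d = 0" "T' (bar j) (hol i) c d = 0"
proof -
  show "T' (hol i) (bar j) c d = 0"
    by (simp add: T'_eq nabla_torsion_mixed eigen_hol eigen_bar p cvf_E form_0_left ctangent_intros)
  then show "T' (bar j) (hol i) c d = 0" by (subst T'_antisym) simp
qed

lemma R_pure: "R (hol i) (hol j) c d = 0" "R (bar i) (bar j) c d = 0"
  unfolding R_eq
  by (rule form_eigen[where c = \<i>], simp_all add: cvf_intros p eigen_curv eigen_hol)
    (rule form_eigen[where c = "- \<i>"], simp_all add: cvf_intros p eigen_curv eigen_bar)

text \<open>The sign comes from turning \<open>T s c d\<close> into \<open>T c s d\<close>, the
  index order of the final identities.\<close>

lemma form_tor_tor:
  "form p (tor (tor (E a) (E b)) (E c) p) (E (dual d) p) = - (\<Sum>s\<in>UNIV. T c s d * T a b s)"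
proof -
  have "form p (tor (tor (E a) (E b)) (E c) p) (E (dual d) p) = (\<Sum>s\<in>UNIV. T a b s * T s c d)"
    by (subst tor_expand) (simp_all add: T_eq form_sum_left cvf_intros ctangent_intros p)
  then show ?thesis by (simp add: T_antisym[of _ c] sum_negf mult.commute)
qed

lemma form_curv_tor: "form p (curv (tor (E a) (E b)) (E c) (E d) p) (E f p) = (\<Sum>s\<in>UNIV. T a b s * R d f s c)"
  by (subst curv_expand) (simp_all add: T_eq R_eq form_sum_left cvf_intros ctangent_intros p)

lemma first_bianchi_comp:
  "R c (dual d) a b + R a (dual d) b c + R b (dual d) c a =
    T' b c a d + T' c a b d + T' a b c d
    - (\<Sum>s\<in>UNIV. T c s d * T a b s) - (\<Sum>s\<in>UNIV. T a s d * T b c s) - (\<Sum>s\<in>UNIV. T b s d * T c a s)"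
  \<comment> \<open>Subtractions become additions of negatives so that the negated sums of
    \<open>form_tor_tor\<close> can be folded back.\<close>
  unfolding R_eq T'_eq diff_conv_add_uminus form_tor_tor[symmetric]
  using arg_cong[where f = "\<lambda>v. form p v (E (dual d) p)", OF first_bianchi[OF cvf_E cvf_E cvf_E p, of a b c]]
  by (simp add: form_add_left ctangent_intros cvf_intros)

lemma second_bianchi_comp:
  "R' a b c d m + R' a b d m c + R' a b m c d
    + (\<Sum>s\<in>UNIV. T c d s * R a b s m) + (\<Sum>s\<in>UNIV. T d m s * R a b s c) + (\<Sum>s\<in>UNIV. T m c s * R a b s d) = 0"
  unfolding R'_eq form_curv_tor[symmetric]
  using arg_cong[where f = "\<lambda>v. form p v (E b p)", OF second_bianchi[OF cvf_E cvf_E cvf_E cvf_E p, of c d m a]]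
  by (simp add: form_add_left form_0_left ctangent_intros cvf_intros algebra_simps)

text \<open>With f being \<open>hol\<close> or \<open>bar\<close> this moves the summed index of R
  to the last place, at the cost of a sign.\<close>

lemma sum_T_R_antisym:
  "(\<Sum>s\<in>S. T a b (f s) * R c d (f s) m) = - (\<Sum>s\<in>S. T a b (f s) * R c d m (f s))"
  by (simp add: R_antisym[of c d _ m] sum_negf)

section \<open>The nine identities, by types of indices\<close>

lemmas comp_simps = sum_UNIV_sum T_mixed T'_mixed R_pure

text \<open>The upper index \<open>bar j\<close> puts \<open>hol j\<close> in the second place of R,
  next to an unbarred first index, so every curvature term vanishes by
  \<open>R_pure\<close>.\<close>

lemma cyclic_nabla_torsion:
  "T' (hol i) (hol k) (hol l) (bar j) + T' (hol k) (hol l) (hol i) (bar j) + T' (hol l) (hol i) (hol k) (bar j)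
    = (\<Sum>s\<in>UNIV. T (hol i) (hol s) (bar j) * T (hol k) (hol l) (hol s))
      + (\<Sum>s\<in>UNIV. T (hol k) (hol s) (bar j) * T (hol l) (hol i) (hol s))
      + (\<Sum>s\<in>UNIV. T (hol l) (hol s) (bar j) * T (hol i) (hol k) (hol s))"
  using first_bianchi_comp[of "hol l" "bar j" "hol i" "hol k"]
  by (simp add: comp_simps) (simp add: algebra_simps)

text \<open>With one barred direction, one of the three curvature terms is pure and vanishes, the
  other two form the difference, and a single derivative of the torsion survives.\<close>

lemma curvature_swap_hol:
  "R (hol i) (bar j) (hol k) (bar l) - R (hol k) (bar j) (hol i) (bar l)
    = T' (hol i) (hol k) (bar l) (hol j)
      - (\<Sum>s\<in>UNIV. T (hol i) (hol k) (bar s) * T (bar l) (bar s) (hol j))"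
  using first_bianchi_comp[of "bar l" "hol j" "hol i" "hol k"] R_antisym[of "hol k" "bar j" "bar l" "hol i"]
  by (simp add: comp_simps mult.commute)

text \<open>Two directions are barred here; \<open>R_skew\<close> moves the barred first index of
  each remaining curvature term to the second place.\<close>

lemma curvature_swap_bar:
  "R (hol i) (bar j) (hol k) (bar l) - R (hol i) (bar l) (hol k) (bar j)
    = T' (bar j) (bar l) (hol k) (bar i)
      - (\<Sum>s\<in>UNIV. T (hol k) (hol s) (bar i) * T (bar j) (bar l) (hol s))"
  using first_bianchi_comp[of "bar l" "bar i" "hol k" "bar j"] R_skew[of "bar l" "hol i" "hol k" "bar j"]
    R_skew[of "bar j" "hol i" "bar l" "hol k"] R_antisym[of "hol i" "bar j" "bar l" "hol k"]
  by (simp add: comp_simps)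

text \<open>Exchanging j with l and then i with k exchanges the pairs, so the two preceding
  identities are added and the intermediate term \<open>R (hol i) (bar l) (hol k) (bar j)\<close>
  cancels.\<close>

lemma curvature_swap_pairs:
  "R (hol i) (bar j) (hol k) (bar l) - R (hol k) (bar l) (hol i) (bar j)
    = T' (hol i) (hol k) (bar j) (hol l)
      + T' (bar j) (bar l) (hol k) (bar i)
      - (\<Sum>s\<in>UNIV. T (hol k) (hol s) (bar i) * T (bar j) (bar l) (hol s))
      - (\<Sum>s\<in>UNIV. T (bar j) (bar s) (hol l) * T (hol i) (hol k) (bar s))"
  using arg_cong2[where f = "(+)", OF curvature_swap_bar[of i j k l] curvature_swap_hol[of i l k j]]
  by (simp add: mult.commute)

text \<open>Two of the three curvature terms are pure, so the Bianchi identity expresses the third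
  one by the torsion alone.\<close>

lemma curvature_hol_hol:
  "R (hol i) (bar j) (hol k) (hol l)
    = - T' (hol k) (hol l) (bar j) (bar i)
      + (\<Sum>s\<in>UNIV. T (bar j) (bar s) (bar i) * T (hol k) (hol l) (bar s))"
  using first_bianchi_comp[of "bar j" "bar i" "hol k" "hol l"] R_skew[of "hol i" "bar j" "hol k" "hol l"]
  by (simp add: comp_simps)

text \<open>Same lower indices as in \<open>cyclic_nabla_torsion\<close>, but the upper index
  \<open>hol j\<close> keeps all three curvature terms.\<close>

lemma cyclic_curvature:
  "R (hol i) (bar j) (hol k) (hol l) + R (hol k) (bar j) (hol l) (hol i) + R (hol l) (bar j) (hol i) (hol k)
    = T' (hol i) (hol k) (hol l) (hol j)
      + T' (hol k) (hol l) (hol i) (hol j)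
      + T' (hol l) (hol i) (hol k) (hol j)
      - (\<Sum>s\<in>UNIV. T (hol i) (hol s) (hol j) * T (hol k) (hol l) (hol s))
      - (\<Sum>s\<in>UNIV. T (hol k) (hol s) (hol j) * T (hol l) (hol i) (hol s))
      - (\<Sum>s\<in>UNIV. T (hol l) (hol s) (hol j) * T (hol i) (hol k) (hol s))"
  using first_bianchi_comp[of "hol l" "hol j" "hol i" "hol k"]
  by (simp add: comp_simps) (simp add: algebra_simps)

text \<open>No term vanishes by type. Moving the sums to the right costs a sign, which the exchange
  of the last two indices of R absorbs.\<close>

lemma cyclic_nabla_curvature:
  "R' (hol i) (bar j) (hol k) (hol l) (hol m) + R' (hol i) (bar j) (hol l) (hol m) (hol k) + R' (hol i) (bar j) (hol m) (hol k) (hol l)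
    = (\<Sum>s\<in>UNIV. T (hol k) (hol l) (hol s) * R (hol i) (bar j) (hol m) (hol s))
      + (\<Sum>s\<in>UNIV. T (hol l) (hol m) (hol s) * R (hol i) (bar j) (hol k) (hol s))
      + (\<Sum>s\<in>UNIV. T (hol m) (hol k) (hol s) * R (hol i) (bar j) (hol l) (hol s))
      + (\<Sum>s\<in>UNIV. T (hol k) (hol l) (bar s) * R (hol i) (bar j) (hol m) (bar s))
      + (\<Sum>s\<in>UNIV. T (hol l) (hol m) (bar s) * R (hol i) (bar j) (hol k) (bar s))
      + (\<Sum>s\<in>UNIV. T (hol m) (hol k) (bar s) * R (hol i) (bar j) (hol l) (bar s))"
  using second_bianchi_comp[of "hol i" "bar j" "hol k" "hol l" "hol m"]
  by (simp add: comp_simps sum_T_R_antisym[where m = "hol k"] sum_T_R_antisym[where m = "hol l"]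
      sum_T_R_antisym[where m = "hol m"]) (simp add: algebra_simps)

text \<open>Of the three torsions only the one of the two unbarred directions is not of mixed type,
  and both types of its upper index contribute.\<close>

lemma nabla_curvature_swap_hol:
  "R' (hol i) (bar j) (hol k) (bar l) (hol m) - R' (hol i) (bar j) (hol m) (bar l) (hol k)
    = - R' (hol i) (bar j) (hol m) (hol k) (bar l)
      - (\<Sum>s\<in>UNIV. T (hol m) (hol k) (hol s) * R (hol i) (bar j) (hol s) (bar l))
      - (\<Sum>s\<in>UNIV. T (hol m) (hol k) (bar s) * R (hol i) (bar j) (bar s) (bar l))"
  using second_bianchi_comp[of "hol i" "bar j" "hol k" "bar l" "hol m"]
    R'_antisym[of "hol i" "bar j" "bar l" "hol m" "hol k"]
  by (simp add: comp_simps) (simp add: algebra_simps)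

text \<open>Only the torsion of the two barred directions survives. Its two sums carry different
  signs because only in the second is the summed index moved to the last place of R.\<close>

lemma nabla_curvature_swap_bar:
  "R' (hol i) (bar j) (hol k) (bar l) (bar m) - R' (hol i) (bar j) (hol k) (bar m) (bar l)
    = - R' (hol i) (bar j) (bar l) (bar m) (hol k)
      - (\<Sum>s\<in>UNIV. T (bar l) (bar m) (hol s) * R (hol i) (bar j) (hol s) (hol k))
      + (\<Sum>s\<in>UNIV. T (bar l) (bar m) (bar s) * R (hol i) (bar j) (hol k) (bar s))"
  using second_bianchi_comp[of "hol i" "bar j" "hol k" "bar l" "bar m"]
    R'_antisym[of "hol i" "bar j" "bar m" "hol k" "bar l"]
    sum_T_R_antisym[of "bar l" "bar m" bar "hol i" "bar j" "hol k" UNIV]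
  by (simp add: comp_simps) (simp add: algebra_simps)

end

theorem corollary2p1:
  fixes \<A> :: "('a::{t2_space, second_countable_topology}, 'e::euclidean_space) atlas"
    and J :: "'a \<Rightarrow> 'a rvec \<Rightarrow> 'a rvec"
    and g :: "'a \<Rightarrow> 'a rvec \<Rightarrow> 'a rvec \<Rightarrow> real"
    and D :: "'a rfield \<Rightarrow> 'a rfield \<Rightarrow> 'a rfield"
    and U :: "'a set"
    and e :: "'n::finite \<Rightarrow> 'a cfield"
    and p :: 'a
    and i j k l m :: 'n
    and T :: "'n + 'n \<Rightarrow> 'n + 'n \<Rightarrow> 'n + 'n \<Rightarrow> complex"
    and T' R :: "'n + 'n \<Rightarrow> 'n + 'n \<Rightarrow> 'n + 'n \<Rightarrow> 'n + 'n \<Rightarrow> complex"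
    and R' :: "'n + 'n \<Rightarrow> 'n + 'n \<Rightarrow> 'n + 'n \<Rightarrow> 'n + 'n \<Rightarrow> 'n + 'n \<Rightarrow> complex"
  assumes "almost_hermitian \<A> J g"
    and "DIM('e) = 2 * CARD('n)"
    and "canonical_connection \<A> J g D"
    and "unitary_frame \<A> J g U e"
    and "p \<in> U"
    and "T = torsion_comp \<A> D e p"
    and "T' = nabla_torsion_comp \<A> D e p"
    and "R = curvature_comp \<A> g D e p"
    and "R' = nabla_curvature_comp \<A> g D e p"
  shows
  "(T' (hol i) (hol k) (hol l) (bar j) + T' (hol k) (hol l) (hol i) (bar j) + T' (hol l) (hol i) (hol k) (bar j)
     = (\<Sum>s\<in>UNIV. T (hol i) (hol s) (bar j) * T (hol k) (hol l) (hol s))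
       + (\<Sum>s\<in>UNIV. T (hol k) (hol s) (bar j) * T (hol l) (hol i) (hol s))
       + (\<Sum>s\<in>UNIV. T (hol l) (hol s) (bar j) * T (hol i) (hol k) (hol s))) \<and>
   (R (hol i) (bar j) (hol k) (bar l) - R (hol k) (bar j) (hol i) (bar l)
     = T' (hol i) (hol k) (bar l) (hol j)
       - (\<Sum>s\<in>UNIV. T (hol i) (hol k) (bar s) * T (bar l) (bar s) (hol j))) \<and>
   (R (hol i) (bar j) (hol k) (bar l) - R (hol i) (bar l) (hol k) (bar j)
     = T' (bar j) (bar l) (hol k) (bar i)
       - (\<Sum>s\<in>UNIV. T (hol k) (hol s) (bar i) * T (bar j) (bar l) (hol s))) \<and>
   (R (hol i) (bar j) (hol k) (bar l) - R (hol k) (bar l) (hol i) (bar j)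
     = T' (hol i) (hol k) (bar j) (hol l)
       + T' (bar j) (bar l) (hol k) (bar i)
       - (\<Sum>s\<in>UNIV. T (hol k) (hol s) (bar i) * T (bar j) (bar l) (hol s))
       - (\<Sum>s\<in>UNIV. T (bar j) (bar s) (hol l) * T (hol i) (hol k) (bar s))) \<and>
   (R (hol i) (bar j) (hol k) (hol l)
     = - T' (hol k) (hol l) (bar j) (bar i)
       + (\<Sum>s\<in>UNIV. T (bar j) (bar s) (bar i) * T (hol k) (hol l) (bar s))) \<and>
   (R (hol i) (bar j) (hol k) (hol l) + R (hol k) (bar j) (hol l) (hol i) + R (hol l) (bar j) (hol i) (hol k)
     = T' (hol i) (hol k) (hol l) (hol j)
       + T' (hol k) (hol l) (hol i) (hol j)
       + T' (hol l) (hol i) (hol k) (hol j)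
       - (\<Sum>s\<in>UNIV. T (hol i) (hol s) (hol j) * T (hol k) (hol l) (hol s))
       - (\<Sum>s\<in>UNIV. T (hol k) (hol s) (hol j) * T (hol l) (hol i) (hol s))
       - (\<Sum>s\<in>UNIV. T (hol l) (hol s) (hol j) * T (hol i) (hol k) (hol s))) \<and>
   (R' (hol i) (bar j) (hol k) (hol l) (hol m) + R' (hol i) (bar j) (hol l) (hol m) (hol k) + R' (hol i) (bar j) (hol m) (hol k) (hol l)
     = (\<Sum>s\<in>UNIV. T (hol k) (hol l) (hol s) * R (hol i) (bar j) (hol m) (hol s))
       + (\<Sum>s\<in>UNIV. T (hol l) (hol m) (hol s) * R (hol i) (bar j) (hol k) (hol s))
       + (\<Sum>s\<in>UNIV. T (hol m) (hol k) (hol s) * R (hol i) (bar j) (hol l) (hol s))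
       + (\<Sum>s\<in>UNIV. T (hol k) (hol l) (bar s) * R (hol i) (bar j) (hol m) (bar s))
       + (\<Sum>s\<in>UNIV. T (hol l) (hol m) (bar s) * R (hol i) (bar j) (hol k) (bar s))
       + (\<Sum>s\<in>UNIV. T (hol m) (hol k) (bar s) * R (hol i) (bar j) (hol l) (bar s))) \<and>
   (R' (hol i) (bar j) (hol k) (bar l) (hol m) - R' (hol i) (bar j) (hol m) (bar l) (hol k)
     = - R' (hol i) (bar j) (hol m) (hol k) (bar l)
       - (\<Sum>s\<in>UNIV. T (hol m) (hol k) (hol s) * R (hol i) (bar j) (hol s) (bar l))
       - (\<Sum>s\<in>UNIV. T (hol m) (hol k) (bar s) * R (hol i) (bar j) (bar s) (bar l))) \<and>
   (R' (hol i) (bar j) (hol k) (bar l) (bar m) - R' (hol i) (bar j) (hol k) (bar m) (bar l)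
     = - R' (hol i) (bar j) (bar l) (bar m) (hol k)
       - (\<Sum>s\<in>UNIV. T (bar l) (bar m) (hol s) * R (hol i) (bar j) (hol s) (hol k))
       + (\<Sum>s\<in>UNIV. T (bar l) (bar m) (bar s) * R (hol i) (bar j) (hol k) (bar s)))"
proof -
  have "smooth_atlas \<A>" "connection \<A> D" "open U"
    using assms(1,3,4) by (simp_all add: almost_hermitian_def canonical_connection_def unitary_frame_def)
  then interpret unitary_point \<A> U D J g e p
    using assms(1,3-5) by unfold_locales
  show ?thesis
    unfolding assms(6-9)
    by (intro conjI cyclic_nabla_torsion curvature_swap_hol curvature_swap_bar curvature_swap_pairs curvature_hol_hol cyclic_curvature cyclic_nabla_curvature nabla_curvature_swap_hol nabla_curvature_swap_bar)
qed

end
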